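(* Let $\mathcal{H}_A,\mathcal{H}_B$ be finite-dimensional Hilbert spaces with $d_A=\dim\mathcal{H}_A$, $d_B=\dim\mathcal{H}_B$, let $n\in\mathbb{N}$, and let $\rho_{AB}\in\mathcal{S}(\mathcal{H}_A\otimes\mathcal{H}_B)$ be a state that admits a Bose-symmetric double-sided $n$-extension, i.e. there is a state $\rho_{A_1^nB_1^n}\in\mathcal{S}(\mathcal{H}_A^{\otimes n}\otimes\mathcal{H}_B^{\otimes n})$ with $\rho_{A_1B_1}=\rho_{AB}$ that is Bose-symmetric over the $A$-systems with respect to $B_1^n$ and Bose-symmetric over the $B$-systems with respect to $A_1^n$. Then there exists a separable state $\tilde\rho_{AB}\in\mathrm{SEP}(A:B)$ such that $$\lVert\rho_{AB}-\tilde\rho_{AB}\rVert_1\le4d_Ad_B\,\frac{\sqrt{4\ln2\,(d_A-1)\log(n+d_A)}}{n}.$$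
   Context: $\log$ is base 2; $\lVert\cdot\rVert_1$ is the trace norm. $\mathrm{SEP}(A:B)=\mathrm{conv}\{\rho_A\otimes\sigma_B\}$ over states. Let $U(\sigma)$, $\sigma\in S_n$, denote the permutation of tensor factors. $\rho_{A_1^nB_1^n}$ is Bose-symmetric over the $B$-systems with respect to $A_1^n$ if $(1\otimes U_{B_1^n}(\sigma))\rho_{A_1^nB_1^n}=\rho_{A_1^nB_1^n}$ for all $\sigma\in S_n$ (i.e. it is supported on the symmetric subspace of $\mathcal{H}_B^{\otimes n}$ in the $B$-systems); analogously for $A$. *)

theory Defs
  imports "HOL-Analysis.Analysis"
begin

text \<open>
  A finite-dimensional Hilbert space with a chosen orthonormal basis indexed by a finite type
  \<open>'i\<close> is \<open>complex ^ 'i\<close>, and \<open>H\<^sub>A \<otimes> H\<^sub>B\<close> is \<open>complex ^ ('a \<times> 'b)\<close>. The \<open>n\<close>-fold tensor power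
  of \<open>complex ^ 'a\<close> is \<open>complex ^ ('n \<Rightarrow> 'a)\<close> with \<open>n = CARD('n)\<close>: the elements of \<open>'n\<close> label the
  tensor factors, and \<open>f :: 'n \<Rightarrow> 'a\<close> stands for the product basis vector whose factor \<open>i\<close> is
  the basis vector \<open>f i\<close>.
\<close>

type_synonym 'i op = "complex ^ 'i ^ 'i"

definition dagger :: "'i::finite op \<Rightarrow> 'i op" where
  "dagger M = (\<chi> i j. cnj (M $ j $ i))"

text \<open>Over the complex numbers, nonnegativity of the quadratic form entails that \<open>M\<close> is Hermitian.\<close>

definition positive_op :: "'i::finite op \<Rightarrow> bool" where
  "positive_op M \<longleftrightarrow> (\<forall>v. (\<Sum>i\<in>UNIV. cnj (v $ i) * (M *v v) $ i) \<in> \<real>\<^sub>\<ge>\<^sub>0)"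

definition state :: "'i::finite op \<Rightarrow> bool" where
  "state M \<longleftrightarrow> positive_op M \<and> trace M = 1"

text \<open>\<open>op_sqrt M\<close> is meaningful for positive \<open>M\<close>, whose positive square root exists and is unique.\<close>

definition op_sqrt :: "'i::finite op \<Rightarrow> 'i op" where
  "op_sqrt M = (THE P. positive_op P \<and> P ** P = M)"

definition trace_norm :: "'i::finite op \<Rightarrow> real" where
  "trace_norm M = Re (trace (op_sqrt (dagger M ** M)))"

definition tensor_op :: "'i::finite op \<Rightarrow> 'j::finite op \<Rightarrow> ('i \<times> 'j) op" where
  "tensor_op M N = (\<chi> p q. M $ fst p $ fst q * N $ snd p $ snd q)"

definition SEP :: "('a::finite \<times> 'b::finite) op set" where
  "SEP = convex hull {tensor_op \<rho> \<sigma> | \<rho> \<sigma>. state \<rho> \<and> state \<sigma>}"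

text \<open>The operator permuting tensor factors: the content of factor \<open>i\<close> is moved to factor \<open>\<pi> i\<close>,
  so the basis vector \<open>g\<close> is sent to the basis vector \<open>g \<circ> inv \<pi>\<close>.\<close>

definition perm_op :: "('n::finite \<Rightarrow> 'n) \<Rightarrow> ('n \<Rightarrow> 'a::finite) op" where
  "perm_op \<pi> = (\<chi> f g. if f = g \<circ> inv \<pi> then 1 else 0)"

definition bose_symmetric_A :: "(('n::finite \<Rightarrow> 'a::finite) \<times> 'j::finite) op \<Rightarrow> bool" where
  "bose_symmetric_A R \<longleftrightarrow> (\<forall>\<pi>. bij \<pi> \<longrightarrow> tensor_op (perm_op \<pi>) (mat 1) ** R = R)"

definition bose_symmetric_B :: "('i::finite \<times> ('n::finite \<Rightarrow> 'b::finite)) op \<Rightarrow> bool" where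
  "bose_symmetric_B R \<longleftrightarrow> (\<forall>\<pi>. bij \<pi> \<longrightarrow> tensor_op (mat 1) (perm_op \<pi>) ** R = R)"

text \<open>The reduced operator on the systems \<open>A\<^sub>kB\<^sub>k\<close>, i.e. the partial trace over all other tensor
  factors: row and column index agree away from factor \<open>k\<close>, and one sums over these common
  values.\<close>

definition reduced_op ::
    "'n \<Rightarrow> (('n::finite \<Rightarrow> 'a::finite) \<times> ('n \<Rightarrow> 'b::finite)) op \<Rightarrow> ('a \<times> 'b) op" where
  "reduced_op k R = (\<chi> p q. \<Sum>f | f k = fst p. \<Sum>g | g k = snd p.
     R $ (f, g) $ (f(k := fst q), g(k := snd q)))"

text \<open>The element \<open>k\<close> is the label of the first \<open>A\<close>-system and of the first \<open>B\<close>-system.\<close>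

definition bose_double_extension ::
    "'n \<Rightarrow> (('n::finite \<Rightarrow> 'a::finite) \<times> ('n \<Rightarrow> 'b::finite)) op \<Rightarrow> ('a \<times> 'b) op \<Rightarrow> bool" where
  "bose_double_extension k R \<rho> \<longleftrightarrow>
     state R \<and> reduced_op k R = \<rho> \<and> bose_symmetric_A R \<and> bose_symmetric_B R"

end

theory Submission
  imports Defs "HOL-Combinatorics.Multiset_Permutations"
begin

text \<open>
  Measuring the \<open>B\<close>-systems of the extension in Gaussian coherent states \<open>\<psi> \<otimes> \<dots> \<otimes> \<psi>\<close> and preparing
  \<open>\<psi>\<close> yields a separable state. Its moments of order \<open>n + 1\<close> are given by Wick's formula, and the
  Bose symmetry on the \<open>B\<close>-side collapses them to \<open>(n \<rho> + \<rho>\<^sub>A \<otimes> 1) / (n + d\<^sub>B)\<close>. This state is at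
  distance at most \<open>2 d\<^sub>B / (n + d\<^sub>B)\<close> from \<open>\<rho>\<close>, which is below the claimed bound as soon as
  \<open>d\<^sub>A \<ge> 2\<close>; for \<open>d\<^sub>A = 1\<close> the state \<open>\<rho>\<close> is itself a product. A quadrature formula with finitely
  many nodes replaces the Gaussian integral, so that the prepared state is a finite convex
  combination of product states.
\<close>

section \<open>Hermitian matrices\<close>

text \<open>Degree n + 1 arises because an outcome vector psi enters n times through the measurement
  and once through the preparation. In Wick's formula the prepared psi is paired either with its own
  conjugate, which leaves rho_A tensor 1, or with one of the n measured copies, each of which gives
  rho; taking traces yields the normalisation n + d_B. The error is therefore (d_B rho - rho_A
  tensor 1) / (n + d_B), a difference of two positive operators of equal trace. Gaussian vectors are
  more convenient than unit vectors because their coordinates are independent, so a quadrature in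
  one complex variable suffices; the varying norms only change the weights. On the norm side,
  \<open>op_sqrt\<close> is a definite description, so evaluating \<open>trace_norm\<close> takes
  existence and uniqueness of positive square roots, and hence a spectral theorem.\<close>

definition cdot :: "complex ^ 'i::finite \<Rightarrow> complex ^ 'i \<Rightarrow> complex" where
  "cdot v w = (\<Sum>i\<in>UNIV. cnj (v $ i) * w $ i)"

lemma cdot_add_left: "cdot (u + v) w = cdot u w + cdot v w"
  by (simp add: cdot_def sum.distrib algebra_simps)

lemma cdot_add_right: "cdot u (v + w) = cdot u v + cdot u w"
  by (simp add: cdot_def sum.distrib algebra_simps)

lemma cdot_diff_right: "cdot u (v - w) = cdot u v - cdot u w"
  by (simp add: cdot_def sum_subtractf algebra_simps)

lemma cdot_scale_left: "cdot (c *s v) w = cnj c * cdot v w"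
  by (simp add: cdot_def sum_distrib_left mult_ac)

lemma cdot_scale_right: "cdot v (c *s w) = c * cdot v w"
  by (simp add: cdot_def sum_distrib_left mult_ac)

lemma cdot_sum_right: "cdot v (sum f S) = (\<Sum>x\<in>S. cdot v (f x))"
  by (simp add: cdot_def sum_distrib_left) (rule sum.swap)

lemma cnj_cdot: "cnj (cdot v w) = cdot w v"
  by (simp add: cdot_def mult_ac)

lemma cdot_zero_right [simp]: "cdot v 0 = 0"
  by (simp add: cdot_def)

lemma cdot_self: "cdot v v = of_real ((norm v)\<^sup>2)"
proof -
  have "(norm v)\<^sup>2 = (\<Sum>i\<in>UNIV. (norm (v $ i))\<^sup>2)"
    by (simp add: norm_vec_def L2_set_def sum_nonneg)
  then show ?thesis
    by (simp add: cdot_def complex_norm_square mult_ac del: of_real_power)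
qed

lemma cdot_dagger: "cdot v (M *v w) = cdot (dagger M *v v) w"
  unfolding cdot_def matrix_vector_mult_def dagger_def
  by (simp add: sum_distrib_left sum_distrib_right) (subst sum.swap, simp add: mult_ac)

lemma cdot_axis_left: "cdot (axis i 1) v = v $ i"
  by (simp add: cdot_def axis_def if_distrib[of cnj] if_distrib[of "\<lambda>x. x * _"] cong: if_cong)

lemma matrix_vector_axis: "M *v axis j (1::complex) = (\<chi> i. M $ i $ j)"
  by (simp add: matrix_vector_mult_def axis_def vec_eq_iff if_distrib[of "\<lambda>x. _ * x"] cong: if_cong)

lemma cdot_axis_axis: "cdot (axis i 1) (M *v axis j 1) = M $ i $ j"
  by (simp add: cdot_axis_left matrix_vector_axis)

lemma positive_op_cdot: "positive_op M \<longleftrightarrow> (\<forall>v. cdot v (M *v v) \<in> \<real>\<^sub>\<ge>\<^sub>0)"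
  by (simp add: positive_op_def cdot_def)

lemma continuous_on_cdot [continuous_intros]:
  assumes "continuous_on S f" "continuous_on S g"
  shows "continuous_on S (\<lambda>x. cdot (f x) (g x))"
  unfolding cdot_def using assms by (intro continuous_intros)

text \<open>Polarisation: the real form at \<open>u + w\<close> forces the imaginary parts of the
  two cross terms to cancel, and replacing \<open>w\<close> by \<open>\<i> *s w\<close> equates
  their real parts.\<close>

lemma positive_op_hermitian:
  assumes "positive_op M"
  shows "dagger M = M"
proof -
  have re: "Im (cdot v (M *v v)) = 0" for v
    using assms by (auto simp: positive_op_cdot complex_nonneg_Reals_iff)
  have 1: "Im (cdot u (M *v w) + cdot w (M *v u)) = 0" for u w
    using re[of "u + w"] re[of u] re[of w]
    by (simp add: cdot_add_left cdot_add_right matrix_vector_right_distrib)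
  have 2: "Re (cdot u (M *v w)) = Re (cdot w (M *v u))" for u w
    using 1[of u "\<i> *s w"] by (simp add: cdot_scale_left cdot_scale_right vector_scalar_commute)
  have "cnj (M $ j $ i) = M $ i $ j" for i j
    using 1[of "axis i 1" "axis j 1"] 2[of "axis i 1" "axis j 1"]
    by (auto simp: cdot_axis_axis complex_eq_iff)
  then show ?thesis by (simp add: dagger_def vec_eq_iff)
qed

text \<open>A trace count: if every basis vector equalled its projection onto the span of
  \<open>B\<close>, that projection would be the identity, yet its trace is \<open>card B\<close>,
  not \<open>CARD('i)\<close>.\<close>

lemma orthogonal_vector_exists:
  fixes B :: "(complex ^ 'i::finite) set"
  assumes "finite B" "card B < CARD('i)"
    and "\<And>u v. u \<in> B \<Longrightarrow> v \<in> B \<Longrightarrow> cdot u v = (if u = v then 1 else 0)"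
  shows "\<exists>x. x \<noteq> 0 \<and> (\<forall>u\<in>B. cdot u x = 0)"
proof (rule ccontr)
  assume contra: "\<not> ?thesis"
  define x where "x j = axis j 1 - (\<Sum>u\<in>B. cnj (u $ j) *s u)" for j
  have "cdot v (x j) = 0" if "v \<in> B" for v j
  proof -
    have "cdot v (axis j 1) = cnj (v $ j)"
      by (metis cdot_axis_left cnj_cdot)
    moreover have "cdot v (\<Sum>u\<in>B. cnj (u $ j) *s u) = cnj (v $ j)"
    proof -
      have "cdot v (\<Sum>u\<in>B. cnj (u $ j) *s u) = (\<Sum>u\<in>B. cnj (u $ j) * (if v = u then 1 else 0))"
        unfolding cdot_sum_right cdot_scale_right using that assms(3) by (intro sum.cong) auto
      then show ?thesis using that assms(1) by (simp add: if_distrib cong: if_cong)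
    qed
    ultimately show ?thesis by (simp add: x_def cdot_diff_right)
  qed
  with contra have "x j = 0" for j by blast
  then have "(\<Sum>u\<in>B. cnj (u $ j) *s u) $ j = 1" for j
    by (metis axis_nth eq_iff_diff_eq_0 x_def)
  then have "(\<Sum>u\<in>B. cnj (u $ j) * u $ j) = 1" for j by simp
  then have "(\<Sum>j\<in>(UNIV::'i set). \<Sum>u\<in>B. cnj (u $ j) * u $ j) = of_nat CARD('i)" by simp
  then have "(\<Sum>u\<in>B. cdot u u) = of_nat CARD('i)"
    unfolding cdot_def by (subst sum.swap)
  then have "of_nat (card B) = (of_nat CARD('i) :: complex)"
    using assms by simp
  with assms(2) show False by simp
qed

text \<open>Variational proof: \<open>v\<close> maximises the quadratic form over the unit vectors
  orthogonal to \<open>B\<close>, and the residual \<open>w\<close> vanishes because moving from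
  \<open>v\<close> towards \<open>w\<close> would otherwise raise the Rayleigh quotient.\<close>

lemma eigenvector_in_orthogonal_complement:
  fixes M :: "'i::finite op"
  assumes herm: "dagger M = M" and B: "finite B" "card B < CARD('i)"
    and orth: "\<And>u v. u \<in> B \<Longrightarrow> v \<in> B \<Longrightarrow> cdot u v = (if u = v then 1 else 0)"
    and eig: "\<And>u. u \<in> B \<Longrightarrow> \<exists>c::real. M *v u = of_real c *s u"
  shows "\<exists>v. cdot v v = 1 \<and> (\<forall>u\<in>B. cdot u v = 0) \<and> (\<exists>c::real. M *v v = of_real c *s v)"
proof -
  define S where "S = {v. norm v = 1 \<and> (\<forall>u\<in>B. cdot u v = 0)}"
  define q where "q v = Re (cdot v (M *v v))" for v
  have realq: "cdot v (M *v v) = of_real (q v)" for v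
    using cnj_cdot[of v "M *v v"] cdot_dagger[of v M v] herm
    by (simp add: q_def complex_eq_iff)
  have scale: "cdot (of_real t *s x) (M *v (of_real t *s x)) = of_real (t\<^sup>2) * cdot x (M *v x)" for t :: real and x
    by (simp add: cdot_scale_left cdot_scale_right vector_scalar_commute power2_eq_square)
  have qscale: "q (of_real t *s x) = t\<^sup>2 * q x" for t x
    by (simp add: q_def scale del: of_real_power)
  have nscale: "norm (complex_of_real t *s x) = \<bar>t\<bar> * norm x" for t and x :: "complex ^ 'i"
  proof -
    have "complex_of_real ((norm (complex_of_real t *s x))\<^sup>2) = of_real ((\<bar>t\<bar> * norm x)\<^sup>2)"
      using cdot_self[of "complex_of_real t *s x"]
      unfolding cdot_scale_left cdot_scale_right cdot_self[of x] power_mult_distrib power2_abs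
      by (simp add: power2_eq_square mult_ac)
    then have "(norm (complex_of_real t *s x))\<^sup>2 = (\<bar>t\<bar> * norm x)\<^sup>2"
      by (simp only: of_real_eq_iff)
    then show ?thesis by (simp add: power2_eq_iff_nonneg)
  qed
  have "S = sphere 0 1 \<inter> (\<Inter>u\<in>B. {v. cdot u v = 0})"
    by (auto simp: S_def)
  moreover have "closed {v. cdot u v = 0}" for u :: "complex ^ 'i"
    by (intro closed_Collect_eq continuous_intros)
  ultimately have "compact S"
    by (auto intro!: compact_Int_closed closed_INT)
  moreover have "S \<noteq> {}"
  proof -
    obtain x where x: "x \<noteq> 0" "\<forall>u\<in>B. cdot u x = 0"
      using orthogonal_vector_exists[OF B orth] by blast
    then have "of_real (1 / norm x) *s x \<in> S"
      using nscale[of "1 / norm x" x] by (auto simp: S_def cdot_scale_right)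
    then show ?thesis by blast
  qed
  moreover have "continuous_on S q"
    unfolding q_def cdot_def matrix_vector_mult_def vec_lambda_beta by (intro continuous_intros)
  ultimately have "\<exists>v\<in>S. \<forall>y\<in>S. q y \<le> q v"
    by (rule continuous_attains_sup)
  then obtain v where v: "v \<in> S" and max: "\<And>y. y \<in> S \<Longrightarrow> q y \<le> q v"
    by blast
  have vv: "cdot v v = 1" and perp: "\<And>u. u \<in> B \<Longrightarrow> cdot u v = 0"
    using v by (auto simp: S_def cdot_self)
  define w where "w = M *v v - of_real (q v) *s v"
  have bound: "q x \<le> q v * (norm x)\<^sup>2" if "\<And>u. u \<in> B \<Longrightarrow> cdot u x = 0" for x
  proof (cases "x = 0")
    case True
    then show ?thesis by (simp add: q_def)
  next
    case False
    then have "of_real (1 / norm x) *s x \<in> S"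
      using that nscale[of "1 / norm x" x] by (auto simp: S_def cdot_scale_right)
    from max[OF this] False show ?thesis
      unfolding qscale by (simp add: field_simps power2_eq_square)
  qed
  \<comment> \<open>The vectors of \<open>B\<close> are eigenvectors and \<open>M\<close> is
    Hermitian, so \<open>M\<close> maps the orthogonal complement of \<open>B\<close> into itself;
    thus \<open>w\<close> is an admissible direction.\<close>
  have uw: "cdot u w = 0" if "u \<in> B" for u
  proof -
    obtain c :: real where c: "M *v u = of_real c *s u" using eig \<open>u \<in> B\<close> by blast
    have "cdot u (M *v v) = cdot (M *v u) v" using cdot_dagger[of u M v] herm by simp
    then show ?thesis using perp[OF that] c
      by (simp add: w_def cdot_diff_right cdot_scale_right cdot_scale_left)
  qed
  have vw: "cdot v w = 0"
    by (simp add: w_def cdot_diff_right cdot_scale_right realq vv)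
  then have wv: "cdot w v = 0" by (metis cnj_cdot complex_cnj_zero)
  have wMv: "cdot w (M *v v) = of_real ((norm w)\<^sup>2)"
  proof -
    have "M *v v = w + of_real (q v) *s v" by (simp add: w_def)
    then show ?thesis using cdot_self[of w] by (simp add: cdot_add_right cdot_scale_right wv)
  qed
  then have vMw: "cdot v (M *v w) = of_real ((norm w)\<^sup>2)"
    using cdot_dagger[of v M w] herm cnj_cdot[of w "M *v v"] by simp
  have ineq: "2 * t * (norm w)\<^sup>2 \<le> t\<^sup>2 * (q v * (norm w)\<^sup>2 - q w)" for t :: real
  proof -
    let ?x = "v + of_real t *s w"
    have "cdot ?x ?x = of_real (1 + t\<^sup>2 * (norm w)\<^sup>2)"
      by (simp add: cdot_add_left cdot_add_right cdot_scale_left cdot_scale_right vv vw wv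
          cdot_self[of w] power2_eq_square)
    then have nx: "(norm ?x)\<^sup>2 = 1 + t\<^sup>2 * (norm w)\<^sup>2"
      unfolding cdot_self of_real_eq_iff .
    have "cdot ?x (M *v ?x) = of_real (q v + 2 * t * (norm w)\<^sup>2 + t\<^sup>2 * q w)"
      by (simp add: cdot_add_left cdot_add_right cdot_scale_left cdot_scale_right
          matrix_vector_right_distrib vector_scalar_commute realq wMv vMw power2_eq_square algebra_simps)
    then have qx: "q ?x = q v + 2 * t * (norm w)\<^sup>2 + t\<^sup>2 * q w"
      unfolding realq of_real_eq_iff .
    have "q ?x \<le> q v * (norm ?x)\<^sup>2"
      by (rule bound) (simp add: cdot_add_right cdot_scale_right perp uw)
    then show ?thesis unfolding qx nx by (simp add: algebra_simps)
  qed
  have "w = 0"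
  proof (rule ccontr)
    assume "w \<noteq> 0"
    define a where "a = (norm w)\<^sup>2"
    define C where "C = q v * (norm w)\<^sup>2 - q w"
    have a: "a > 0" using \<open>w \<noteq> 0\<close> by (simp add: a_def)
    \<comment> \<open>The step length \<open>a / (\<bar>C\<bar> + 1)\<close> is so short that the
      quadratic term is at most half of the linear one; adding 1 keeps the denominator
      positive.\<close>
    have "2 * (a / (\<bar>C\<bar> + 1)) * a \<le> (a / (\<bar>C\<bar> + 1))\<^sup>2 * C"
      using ineq[of "a / (\<bar>C\<bar> + 1)"] by (simp add: a_def C_def)
    also have "\<dots> \<le> (a / (\<bar>C\<bar> + 1))\<^sup>2 * (\<bar>C\<bar> + 1)"
      by (intro mult_left_mono) auto
    also have "\<dots> = (a / (\<bar>C\<bar> + 1)) * a"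
      by (simp add: power2_eq_square)
    finally have "(a / (\<bar>C\<bar> + 1)) * a \<le> 0" by simp
    moreover have "(a / (\<bar>C\<bar> + 1)) * a > 0" using a by (simp add: add_nonneg_pos)
    ultimately show False by simp
  qed
  then have "M *v v = of_real (q v) *s v" by (simp add: w_def)
  then show ?thesis using vv perp by blast
qed

theorem hermitian_eigenbasis:
  fixes M :: "'i::finite op"
  assumes "dagger M = M"
  obtains u :: "'i \<Rightarrow> complex ^ 'i" and c :: "'i \<Rightarrow> real"
  where "\<And>i j. cdot (u i) (u j) = (if i = j then 1 else 0)"
    and "\<And>i. M *v u i = of_real (c i) *s u i"
proof -
  have "m \<le> CARD('i) \<Longrightarrow> \<exists>B. finite B \<and> card B = m \<and>
      (\<forall>u\<in>B. \<forall>v\<in>B. cdot u v = (if u = v then 1 else 0)) \<and>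
      (\<forall>u\<in>B. \<exists>c::real. M *v u = of_real c *s u)" for m
  proof (induction m)
    case 0
    then show ?case by (intro exI[of _ "{}"]) auto
  next
    case (Suc m)
    then obtain B where B: "finite B" "card B = m"
      "\<forall>u\<in>B. \<forall>v\<in>B. cdot u v = (if u = v then 1 else 0)"
      "\<forall>u\<in>B. \<exists>c::real. M *v u = of_real c *s u" by auto
    with Suc.prems obtain v where v: "cdot v v = 1" "\<forall>u\<in>B. cdot u v = 0"
        "\<exists>c::real. M *v v = of_real c *s v"
      using eigenvector_in_orthogonal_complement[OF assms, of B] by auto
    have "\<forall>u\<in>B. cdot v u = 0" using v(2) by (metis cnj_cdot complex_cnj_zero)
    moreover have "v \<notin> B" using v by force
    ultimately show ?case using B v by (intro exI[of _ "insert v B"]) auto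
  qed
  then obtain B where B: "finite B" "card B = CARD('i)"
      "\<forall>u\<in>B. \<forall>v\<in>B. cdot u v = (if u = v then 1 else 0)"
      "\<forall>u\<in>B. \<exists>c::real. M *v u = of_real c *s u" by blast
  \<comment> \<open>Labelling the eigenvectors by the index type makes them the columns of a square
    matrix, which \<open>orthonormal_completeness\<close> exploits.\<close>
  obtain u where u: "bij_betw u (UNIV :: 'i set) B"
    using B(1,2) finite_same_card_bij[of "UNIV :: 'i set" B] by auto
  have uB: "u i \<in> B" for i using u by (auto simp: bij_betw_def)
  have "\<forall>i. \<exists>c::real. M *v u i = of_real c *s u i" using B(4) uB by blast
  then obtain c :: "'i \<Rightarrow> real" where "\<And>i. M *v u i = of_real (c i) *s u i" by metis
  moreover have "cdot (u i) (u j) = (if i = j then 1 else 0)" for i j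
    using B(3) uB u by (auto simp: bij_betw_def inj_def)
  ultimately show thesis using that by blast
qed

section \<open>Expansions in an orthonormal basis\<close>

context
  fixes u :: "'i::finite \<Rightarrow> complex ^ 'i"
  assumes orth: "\<And>i j. cdot (u i) (u j) = (if i = j then 1 else 0)"
begin

text \<open>The matrix with columns \<open>u k\<close> is square, so its left inverse
  \<open>dagger U\<close> is also a right inverse.\<close>

lemma orthonormal_completeness: "(\<Sum>k\<in>UNIV. u k $ i * cnj (u k $ j)) = (if i = j then 1 else 0)"
proof -
  define U :: "'i op" where "U = (\<chi> i k. u k $ i)"
  have "dagger U ** U = mat 1"
    using orth by (simp add: matrix_matrix_mult_def dagger_def mat_def vec_eq_iff U_def cdot_def)
  then have "U ** dagger U = mat 1"
    using matrix_left_right_inverse by blast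
  then have "(U ** dagger U) $ i $ j = mat 1 $ i $ j" by simp
  then show ?thesis
    by (simp add: matrix_matrix_mult_def dagger_def mat_def U_def)
qed

lemma orthonormal_expansion: "v = (\<Sum>k\<in>UNIV. cdot (u k) v *s u k)"
proof -
  have "(\<Sum>k\<in>UNIV. cdot (u k) v *s u k) $ i = v $ i" for i
  proof -
    have "(\<Sum>k\<in>UNIV. cdot (u k) v *s u k) $ i
        = (\<Sum>j\<in>UNIV. v $ j * (\<Sum>k\<in>UNIV. u k $ i * cnj (u k $ j)))"
      unfolding cdot_def by (simp add: sum_distrib_left sum_distrib_right)
        (subst sum.swap, simp add: mult_ac)
    then show ?thesis by (simp add: orthonormal_completeness if_distrib cong: if_cong)
  qed
  then show ?thesis by (simp add: vec_eq_iff)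
qed

lemma eq_on_orthonormal_basis:
  assumes "\<And>k. M *v u k = N *v u k"
  shows "M = (N :: 'i op)"
proof -
  have "M *v v = N *v v" for v
  proof -
    have "K *v v = (\<Sum>k\<in>UNIV. cdot (u k) v *s (K *v u k))" for K :: "'i op"
      by (subst orthonormal_expansion[of v])
         (simp add: vec.linear_sum[OF matrix_vector_mul_linear_gen] vector_scalar_commute)
    from this[of M] this[of N] show ?thesis by (simp add: assms)
  qed
  then show ?thesis by (simp add: matrix_eq)
qed

lemma trace_orthonormal: "trace M = (\<Sum>k\<in>UNIV. cdot (u k) (M *v u k))"
proof -
  have "(\<Sum>k\<in>UNIV. cdot (u k) (M *v u k))
     = (\<Sum>k\<in>UNIV. \<Sum>i\<in>UNIV. \<Sum>j\<in>UNIV. M $ i $ j * (u k $ j * cnj (u k $ i)))"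
    unfolding cdot_def matrix_vector_mult_def by (simp add: sum_distrib_left mult_ac)
  also have "\<dots> = (\<Sum>i\<in>UNIV. \<Sum>k\<in>UNIV. \<Sum>j\<in>UNIV. M $ i $ j * (u k $ j * cnj (u k $ i)))"
    by (rule sum.swap)
  also have "\<dots> = (\<Sum>i\<in>UNIV. \<Sum>j\<in>UNIV. \<Sum>k\<in>UNIV. M $ i $ j * (u k $ j * cnj (u k $ i)))"
    by (intro sum.cong refl sum.swap)
  finally have "(\<Sum>k\<in>UNIV. cdot (u k) (M *v u k))
     = (\<Sum>i\<in>UNIV. \<Sum>j\<in>UNIV. M $ i $ j * (\<Sum>k\<in>UNIV. u k $ j * cnj (u k $ i)))"
    by (simp add: sum_distrib_left)
  then show ?thesis by (simp add: orthonormal_completeness trace_def if_distrib cong: if_cong)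
qed

end

text \<open>The form at \<open>v\<close> becomes a sum of squared moduli, one for each
  \<open>x\<close>. The index set \<open>X\<close> is free so that traced-out coordinates can be
  made part of it.\<close>

lemma positive_op_gram:
  assumes "\<And>p q. N $ p $ q = (\<Sum>x\<in>X. y x p * cnj (y x q))"
  shows "positive_op N"
  unfolding positive_op_cdot
proof
  fix v
  let ?t = "\<lambda>p q x. cnj (v $ p) * y x p * (v $ q * cnj (y x q))"
  have "cdot v (N *v v) = (\<Sum>p\<in>UNIV. \<Sum>q\<in>UNIV. \<Sum>x\<in>X. ?t p q x)"
    unfolding cdot_def matrix_vector_mult_def
    by (simp add: assms sum_distrib_left sum_distrib_right mult_ac)
  also have "\<dots> = (\<Sum>p\<in>UNIV. \<Sum>x\<in>X. \<Sum>q\<in>UNIV. ?t p q x)"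
    by (intro sum.cong refl sum.swap)
  also have "\<dots> = (\<Sum>x\<in>X. \<Sum>p\<in>UNIV. \<Sum>q\<in>UNIV. ?t p q x)"
    by (rule sum.swap)
  also have "\<dots> = (\<Sum>x\<in>X. (\<Sum>p\<in>UNIV. cnj (v $ p) * y x p) * cnj (\<Sum>p\<in>UNIV. cnj (v $ p) * y x p))"
    by (simp add: sum_product)
  also have "\<dots> = of_real (\<Sum>x\<in>X. (norm (\<Sum>p\<in>UNIV. cnj (v $ p) * y x p))\<^sup>2)"
    by (simp only: complex_norm_square[symmetric] of_real_sum)
  finally show "cdot v (N *v v) \<in> \<real>\<^sub>\<ge>\<^sub>0"
    by (simp add: sum_nonneg del: of_real_sum of_real_power)
qed

section \<open>Positive square roots and the trace norm\<close>

lemma sqrt_weight: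
  assumes "r \<ge> 0"
  shows "of_real (sqrt r) * a * cnj (of_real (sqrt r) * b) = of_real r * a * cnj b"
proof -
  have "of_real (sqrt r) * a * cnj (of_real (sqrt r) * b) = of_real (sqrt r * sqrt r) * a * cnj b"
    unfolding of_real_mult complex_cnj_mult complex_cnj_complex_of_real by (simp only: mult_ac)
  then show ?thesis using assms by (simp only: real_sqrt_mult_self abs_of_nonneg mult.assoc)
qed

lemma eigen_nonneg:
  assumes "positive_op M" "cdot v v = 1" "M *v v = of_real c *s v"
  shows "c \<ge> 0"
  using assms unfolding positive_op_cdot by (metis cdot_scale_right mult.right_neutral nonneg_Reals_of_real_iff)

text \<open>On an eigenvector u of \<open>Q\<close> with eigenvalue c, the square of
  \<open>P\<close> acts as c^2, so w = P u - c u satisfies P w = - c w. Positivity of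
  \<open>P\<close> excludes a negative eigenvalue, so w = 0 if c > 0; if c = 0, then P u has norm
  zero because \<open>P\<close> is Hermitian.\<close>

lemma positive_op_sqrt_unique:
  fixes P :: "'i::finite op"
  assumes P: "positive_op P" and Q: "positive_op Q" and eq: "P ** P = Q ** Q"
  shows "P = Q"
proof -
  obtain u :: "'i \<Rightarrow> _" and c where orth: "\<And>i j. cdot (u i) (u j) = (if i = j then 1 else 0)"
    and eig: "\<And>i. Q *v u i = of_real (c i) *s u i"
    using hermitian_eigenbasis[OF positive_op_hermitian[OF Q]] by blast
  have hP: "dagger P = P" using positive_op_hermitian[OF P] .
  have "P *v u k = Q *v u k" for k
  proof -
    have c: "c k \<ge> 0" using eigen_nonneg[OF Q _ eig] orth by simp
    have "P *v (P *v u k) = Q *v (Q *v u k)"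
      by (simp only: matrix_vector_mul_assoc eq)
    then have PP: "P *v (P *v u k) = (of_real (c k))\<^sup>2 *s u k"
      by (simp add: eig vector_scalar_commute power2_eq_square)
    show ?thesis
    proof (cases "c k = 0")
      case True
      then have "cdot (P *v u k) (P *v u k) = 0"
        using PP cdot_dagger[of "u k" P "P *v u k"] hP by simp
      then have "P *v u k = 0" by (simp add: cdot_self)
      then show ?thesis using True eig by simp
    next
      case False
      define w where "w = P *v u k - of_real (c k) *s u k"
      have "P *v w = (- of_real (c k)) *s w"
        by (simp add: w_def matrix_vector_mult_diff_distrib PP vector_scalar_commute
            vec_eq_iff algebra_simps power2_eq_square)
      then have "cdot w (P *v w) = - of_real (c k) * cdot w w"
        by (simp only: cdot_scale_right)
      then have "cdot w (P *v w) = of_real (- (c k * (norm w)\<^sup>2))"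
        by (simp add: cdot_self)
      then have "- (c k * (norm w)\<^sup>2) \<ge> 0"
        using P unfolding positive_op_cdot by (metis nonneg_Reals_of_real_iff)
      then have "w = 0" using c False
        by (smt (verit) mult_pos_pos zero_less_norm_iff zero_less_power)
      then show ?thesis by (simp add: w_def eig)
    qed
  qed
  then show ?thesis by (rule eq_on_orthonormal_basis[OF orth])
qed

lemma trace_norm_hermitian:
  fixes H :: "'i::finite op" and u :: "'i \<Rightarrow> complex ^ 'i"
  assumes "dagger H = H" and orth: "\<And>i j. cdot (u i) (u j) = (if i = j then 1 else 0)"
    and eig: "\<And>i. H *v u i = of_real (c i) *s u i"
  shows "trace_norm H = (\<Sum>i\<in>UNIV. \<bar>c i\<bar>)"
proof -
  \<comment> \<open>The modulus of \<open>H\<close>, assembled from its spectral decomposition;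
    being positive with square \<open>H ** H\<close>, it is the operator that \<open>op_sqrt\<close>
    describes.\<close>
  define A where "A = (\<chi> p q. \<Sum>k\<in>UNIV. of_real \<bar>c k\<bar> * u k $ p * cnj (u k $ q))"
  have A: "positive_op A"
    by (rule positive_op_gram[where X = UNIV and y = "\<lambda>k p. of_real (sqrt \<bar>c k\<bar>) * u k $ p"])
       (simp add: A_def sqrt_weight del: complex_cnj_mult)
  have Au: "A *v u i = of_real \<bar>c i\<bar> *s u i" for i
  proof -
    have "(A *v u i) $ p = (\<Sum>k\<in>UNIV. of_real \<bar>c k\<bar> * u k $ p * cdot (u k) (u i))" for p
      unfolding matrix_vector_mult_def cdot_def
      by (simp add: A_def sum_distrib_left sum_distrib_right) (subst sum.swap, simp add: mult_ac)
    then have "(A *v u i) $ p = of_real \<bar>c i\<bar> * u i $ p" for p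
      by (simp add: orth if_distrib[of "\<lambda>x. _ * x"] cong: if_cong)
    then show ?thesis by (simp add: vec_eq_iff)
  qed
  have "A ** A = H ** H"
  proof (rule eq_on_orthonormal_basis[OF orth])
    fix k
    show "(A ** A) *v u k = (H ** H) *v u k"
      by (simp add: matrix_vector_mul_assoc[symmetric] Au eig vector_scalar_commute)
         (simp add: vec_eq_iff flip: of_real_mult)
  qed
  then have "op_sqrt (dagger H ** H) = A"
    unfolding op_sqrt_def assms(1) using A
    by (intro the_equality) (auto intro: positive_op_sqrt_unique)
  then have "trace_norm H = Re (\<Sum>k\<in>UNIV. cdot (u k) (A *v u k))"
    unfolding trace_norm_def using trace_orthonormal[OF orth] by simp
  then show ?thesis by (simp add: Au cdot_scale_right orth)
qed

lemma positive_op_hermitian_diff: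
  assumes "positive_op P" "positive_op Q"
  shows "dagger (P - Q) = P - Q"
proof -
  have "dagger (P - Q) = dagger P - dagger Q" by (simp add: dagger_def vec_eq_iff)
  then show ?thesis using assms by (simp add: positive_op_hermitian)
qed

text \<open>Each eigenvalue of \<open>P - Q\<close> is a difference of nonnegative diagonal entries
  of \<open>P\<close> and \<open>Q\<close> in its eigenbasis, and these diagonals sum to the traces.
  This spares the general triangle inequality.\<close>

lemma trace_norm_diff_le:
  fixes P :: "'i::finite op"
  assumes P: "positive_op P" and Q: "positive_op Q"
  shows "trace_norm (P - Q) \<le> Re (trace P) + Re (trace Q)"
proof -
  have herm: "dagger (P - Q) = P - Q" using positive_op_hermitian_diff[OF P Q] .
  then obtain u :: "'i \<Rightarrow> _" and c where orth: "\<And>i j. cdot (u i) (u j) = (if i = j then 1 else 0)"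
    and eig: "\<And>i. (P - Q) *v u i = of_real (c i) *s u i"
    using hermitian_eigenbasis by blast
  have "\<bar>c i\<bar> \<le> Re (cdot (u i) (P *v u i)) + Re (cdot (u i) (Q *v u i))" for i
  proof -
    have "of_real (c i) = cdot (u i) ((P - Q) *v u i)"
      by (simp add: eig cdot_scale_right orth)
    also have "\<dots> = cdot (u i) (P *v u i) - cdot (u i) (Q *v u i)"
      by (simp add: matrix_vector_mult_diff_rdistrib cdot_diff_right)
    finally have "c i = Re (cdot (u i) (P *v u i)) - Re (cdot (u i) (Q *v u i))"
      by (metis Re_complex_of_real minus_complex.sel(1))
    moreover have "Re (cdot (u i) (P *v u i)) \<ge> 0" "Re (cdot (u i) (Q *v u i)) \<ge> 0"
      using P Q by (auto simp: positive_op_cdot complex_nonneg_Reals_iff)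
    ultimately show ?thesis by simp
  qed
  then have "(\<Sum>i\<in>UNIV. \<bar>c i\<bar>) \<le> (\<Sum>i\<in>UNIV. Re (cdot (u i) (P *v u i)) + Re (cdot (u i) (Q *v u i)))"
    by (rule sum_mono)
  then show ?thesis
    unfolding trace_norm_hermitian[OF herm orth eig] trace_orthonormal[OF orth, of P]
      trace_orthonormal[OF orth, of Q]
    by (simp add: sum.distrib)
qed

text \<open>Eigenvectors scaled by the roots of their eigenvalues serve as Gram vectors. Positivity
  of tensor products, partial traces and contractions is later obtained by transforming these
  vectors and returning through \<open>positive_op_gram\<close>.\<close>

lemma positive_op_imp_gram:
  fixes N :: "'i::finite op"
  assumes "positive_op N"
  obtains y :: "'i \<Rightarrow> 'i \<Rightarrow> complex"
  where "\<And>p q. N $ p $ q = (\<Sum>x\<in>UNIV. y x p * cnj (y x q))"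
proof -
  obtain u :: "'i \<Rightarrow> _" and c where orth: "\<And>i j. cdot (u i) (u j) = (if i = j then 1 else 0)"
    and eig: "\<And>i. N *v u i = of_real (c i) *s u i"
    using hermitian_eigenbasis[OF positive_op_hermitian[OF assms]] by blast
  have c: "c k \<ge> 0" for k using eigen_nonneg[OF assms _ eig] orth by simp
  define y where "y k p = of_real (sqrt (c k)) * u k $ p" for k p
  define A where "A = (\<chi> p q. \<Sum>x\<in>UNIV. y x p * cnj (y x q))"
  have yy: "y k p * cnj (y k q) = of_real (c k) * u k $ p * cnj (u k $ q)" for k p q
    using c[of k] by (simp add: y_def sqrt_weight del: complex_cnj_mult)
  have "N = A"
  proof (rule eq_on_orthonormal_basis[OF orth])
    fix i
    have "(A *v u i) $ p = (\<Sum>k\<in>UNIV. of_real (c k) * u k $ p * cdot (u k) (u i))" for p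
      unfolding matrix_vector_mult_def cdot_def
      by (simp add: A_def yy sum_distrib_left sum_distrib_right) (subst sum.swap, simp add: mult_ac)
    then have "(A *v u i) $ p = of_real (c i) * u i $ p" for p
      by (simp add: orth if_distrib[of "\<lambda>x. _ * x"] cong: if_cong)
    then show "N *v u i = A *v u i"
      by (simp add: vec_eq_iff eig)
  qed
  then show thesis by (intro that[of y]) (simp add: A_def)
qed

text \<open>The trace is the sum of the squared moduli of all Gram coefficients. This handles
  factors of zero trace, which cannot be normalised to states.\<close>

lemma positive_op_trace_0:
  fixes N :: "'i::finite op"
  assumes "positive_op N" "trace N = 0"
  shows "N = 0"
proof -
  obtain y :: "'i \<Rightarrow> 'i \<Rightarrow> complex" where y: "\<And>p q. N $ p $ q = (\<Sum>x\<in>UNIV. y x p * cnj (y x q))"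
    using positive_op_imp_gram[OF assms(1)] by blast
  have "trace N = of_real (\<Sum>p\<in>UNIV. \<Sum>x\<in>UNIV. (norm (y x p))\<^sup>2)"
    unfolding trace_def y by (simp only: complex_norm_square[symmetric] of_real_sum)
  then have "(\<Sum>p\<in>UNIV. \<Sum>x\<in>UNIV. (norm (y x p))\<^sup>2) = 0"
    using assms(2) by (metis of_real_eq_0_iff)
  then have "y x p = 0" for x p
    by (simp add: sum_nonneg_eq_0_iff sum_nonneg)
  then show ?thesis by (simp add: vec_eq_iff y)
qed

section \<open>Quadrature for Gaussian moments\<close>

lemma has_integral_power_exp: "((\<lambda>t::real. t ^ m / exp t) has_integral fact m) {0..}"
\<comment> \<open>The point 0 is excepted because there \<open>powr\<close> with exponent 0 gives 0
  while \<open>^\<close> gives 1.\<close>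
proof (rule has_integral_spike_finite[where S = "{0}"])
  show "((\<lambda>t. t powr (1 + real m - 1) / exp t) has_integral fact m) {0..}"
    using Gamma_integral_real[of "1 + real m"] unfolding Gamma_fact by (simp add: add_pos_nonneg)
qed (auto simp: powr_realpow)

text \<open>If no convex combination of the moment curve hit the vector of factorials, a separating
  hyperplane would be a polynomial that is nonnegative on \<open>[0, \<infinity>)\<close> and whose integral against
  \<open>exp (- t)\<close> is zero.\<close>

lemma factorial_moments:
  assumes inj: "inj (e :: 'i::finite \<Rightarrow> nat)" and e_pos: "\<And>i. e i > 0"
  shows "\<exists>T w. finite T \<and> (\<forall>t\<in>T. t \<ge> 0 \<and> w t \<ge> 0) \<and>
    (\<forall>i. (\<Sum>t\<in>T. w t * t ^ e i) = (fact (e i) :: real)) \<and> sum w T = 1"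
proof -
  define f :: "real \<Rightarrow> real ^ 'i" where "f t = (\<chi> i. t ^ e i - fact (e i))" for t
  have "0 \<in> convex hull (f ` {0..})"
  proof (rule ccontr)
    assume "0 \<notin> convex hull (f ` {0..})"
    then obtain a where a: "a \<noteq> 0" "\<And>x. x \<in> convex hull (f ` {0..}) \<Longrightarrow> 0 \<le> a \<bullet> x"
      using separating_hyperplane_set_0[OF convex_convex_hull] by blast
    define p where "p t = a \<bullet> f t" for t
    have p: "p t = (\<Sum>i\<in>UNIV. a $ i * (t ^ e i - fact (e i)))" for t
      by (simp add: p_def f_def inner_vec_def)
    have pos: "p t \<ge> 0" if "t \<ge> 0" for t
      unfolding p_def by (rule a(2), rule hull_inc) (use that in auto)
    \<comment> \<open>Writing the constant with \<open>t ^ 0\<close> lets one integral formula cover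
      both terms; \<open>fact 0 = 1\<close> then makes every summand integrate to zero.\<close>
    have "((\<lambda>t. \<Sum>i\<in>UNIV. a $ i * (t ^ e i / exp t - fact (e i) * (t ^ 0 / exp t))) has_integral
        (\<Sum>i\<in>UNIV. a $ i * (fact (e i) - fact (e i) * fact 0))) {0..}"
      by (intro has_integral_sum has_integral_mult_right has_integral_diff has_integral_power_exp) auto
    then have int: "((\<lambda>t. p t / exp t) has_integral 0) {0..}"
      by (simp add: p sum_divide_distrib algebra_simps diff_divide_distrib)
    have p0: "p t = 0" if "t \<in> {0..1}" for t
    proof -
      have sub: "((\<lambda>t. p t / exp t) has_integral (integral {0..1} (\<lambda>t. p t / exp t))) {0..1}"
        by (intro integrable_integral integrable_continuous_real) (auto simp: p intro!: continuous_intros)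
      have "integral {0..1} (\<lambda>t. p t / exp t) \<le> 0"
        by (rule has_integral_subset_le[OF _ sub int]) (auto intro!: divide_nonneg_pos pos)
      moreover have "integral {0..1} (\<lambda>t. p t / exp t) \<ge> 0"
        by (rule has_integral_nonneg[OF sub]) (auto intro!: divide_nonneg_pos pos)
      ultimately have "((\<lambda>t. p t / exp t) has_integral 0) (cbox 0 1)" using sub by simp
      then have "p t / exp t = 0"
        using that by (intro has_integral_0_cbox_imp_0[of 0 1 "\<lambda>t. p t / exp t"])
          (auto simp: p intro!: continuous_intros divide_nonneg_pos pos[unfolded p])
      then show ?thesis by simp
    qed
    define P where "P = (\<Sum>i\<in>UNIV. monom (a $ i) (e i)) - [:\<Sum>i\<in>UNIV. a $ i * fact (e i):]"
    have "poly P t = p t" for t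
      by (simp add: P_def p poly_sum poly_monom right_diff_distrib sum_subtractf)
    then have "{0..1} \<subseteq> {t. poly P t = 0}" using p0 by auto
    then have "infinite {t. poly P t = 0}"
      using infinite_Icc[of "0::real" 1] by (meson finite_subset zero_less_one)
    then have "P = 0" using poly_roots_finite by blast
    have "a $ i = 0" for i
    proof -
      \<comment> \<open>Positive exponents keep these coefficients clear of the constant term, and
        injectivity of \<open>e\<close> keeps them from merging.\<close>
      have "coeff P (e i) = (\<Sum>k\<in>UNIV. if e k = e i then a $ k else 0)"
        using e_pos[of i] by (cases "e i") (simp_all add: P_def coeff_sum)
      also have "\<dots> = (\<Sum>k\<in>UNIV. if k = i then a $ k else 0)"
        using inj by (intro sum.cong) (auto dest: injD)
      finally show ?thesis using \<open>P = 0\<close> by simp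
    qed
    then show False using a(1) by (simp add: vec_eq_iff)
  qed
  then obtain S u where S: "finite S" "S \<subseteq> f ` {0..}" "\<And>x. x \<in> S \<Longrightarrow> 0 \<le> u x" "sum u S = 1"
      "(\<Sum>v\<in>S. u v *\<^sub>R v) = 0"
    unfolding convex_hull_explicit by blast
  obtain T where T: "T \<subseteq> {0..}" "inj_on f T" "S = f ` T"
    using S(2) by (metis subset_image_inj)
  show ?thesis
  proof (intro exI[of _ T] exI[of _ "u \<circ> f"] conjI allI)
    show "finite T" using S(1) T by (simp add: finite_image_iff)
    show "sum (u \<circ> f) T = 1" using S(4) T by (simp add: sum.reindex)
    fix i
    have "(\<Sum>t\<in>T. u (f t) *\<^sub>R f t) = 0" using S(5) T by (simp add: sum.reindex)
    then have "(\<Sum>t\<in>T. u (f t) *\<^sub>R f t) $ i = 0" by simp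
    then have "(\<Sum>t\<in>T. u (f t) * (t ^ e i - fact (e i))) = 0"
      by (simp add: f_def)
    then have "(\<Sum>t\<in>T. u (f t) * t ^ e i) = fact (e i) * sum (u \<circ> f) T"
      by (simp add: right_diff_distrib sum_subtractf sum_distrib_left mult_ac)
    then show "(\<Sum>t\<in>T. (u \<circ> f) t * t ^ e i) = fact (e i)"
      using \<open>sum (u \<circ> f) T = 1\<close> by simp
  qed (use T S in auto)
qed

text \<open>The terms form a geometric progression whose ratio is an \<open>N\<close>-th root of
  unity. As both exponents are below \<open>N\<close>, the ratio is 1 only if they coincide.\<close>

lemma sum_roots_of_unity:
  assumes "p < N" "q < N"
  defines "\<omega> \<equiv> cis (2 * pi / real N)"
  shows "(\<Sum>j<N. (\<omega> ^ j) ^ p * cnj (\<omega> ^ j) ^ q) = (if p = q then of_nat N else 0)"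
proof -
  define r where "r = \<omega> ^ p * cnj \<omega> ^ q"
  have unit: "\<omega> * cnj \<omega> = 1" by (simp add: \<omega>_def cis_cnj cis_mult)
  have N: "N > 0" using assms by simp
  have "\<omega> ^ N = 1" unfolding \<omega>_def Complex.DeMoivre using N by simp
  then have rN: "r ^ N = 1"
    unfolding r_def power_mult_distrib power_mult[symmetric]
    by (simp add: mult.commute[of _ N] power_mult flip: complex_cnj_power)
  have sum: "(\<Sum>j<N. (\<omega> ^ j) ^ p * cnj (\<omega> ^ j) ^ q) = (\<Sum>j<N. r ^ j)"
    unfolding r_def by (simp add: power_mult_distrib mult.commute flip: power_mult)
  show ?thesis
  proof (cases "p = q")
    case True
    then have "r = 1" using unit by (simp add: r_def flip: power_mult_distrib)
    then show ?thesis using True sum by simp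
  next
    case False
    have "r \<noteq> 1"
    proof
      assume "r = 1"
      have "\<omega> ^ p = \<omega> ^ p * (\<omega> * cnj \<omega>) ^ q" by (simp add: unit)
      also have "\<dots> = r * \<omega> ^ q" by (simp add: r_def power_mult_distrib)
      finally have "\<omega> ^ p = \<omega> ^ q" using \<open>r = 1\<close> by simp
      moreover have "inj_on (\<lambda>k. cis (2 * pi * real k / real N)) {..<N}"
        using Complex.bij_betw_roots_unity[OF N] by (simp add: bij_betw_def)
      moreover have "\<omega> ^ k = cis (2 * pi * real k / real N)" for k
        by (simp add: \<omega>_def Complex.DeMoivre mult_ac)
      ultimately show False using False assms(1,2) by (auto dest: inj_onD)
    qed
    then show ?thesis using False sum geometric_sum[of r N] rN by simp
  qed
qed

text \<open>These are the moments of a standard complex Gaussian, whose squared modulus is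
  exponentially distributed and independent of its uniform phase. A node is a pair of a value for
  the squared modulus and the number of a root of unity.\<close>

lemma gaussian_moments_quadrature:
  "\<exists>(I :: (real \<times> nat) set) z w. finite I \<and> (\<forall>x\<in>I. w x \<ge> 0) \<and>
    (\<forall>p\<le>Suc CARD('n::finite). \<forall>q\<le>Suc CARD('n).
      (\<Sum>x\<in>I. complex_of_real (w x) * (z x ^ p * cnj (z x) ^ q)) = (if p = q then fact p else 0))"
proof -
  define N where "N = Suc (Suc CARD('n))"
  \<comment> \<open>\<open>factorial_moments\<close> wants its exponents indexed by a type, and
    \<open>'n option\<close> has just enough elements for 1 up to \<open>CARD('n) + 1\<close>.
    Exponent 0 is covered by the total weight.\<close>
  have "CARD('n option) = card {1..Suc CARD('n)}" by (simp add: card_UNIV_option)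
  then obtain e where e: "bij_betw e (UNIV :: 'n option set) {1..Suc CARD('n)}"
    using finite_same_card_bij[of "UNIV :: 'n option set" "{1..Suc CARD('n)}"] by auto
  have "inj e" using e by (simp add: bij_betw_def)
  moreover have "e i > 0" for i
  proof -
    have "e i \<in> {1..Suc CARD('n)}" using bij_betwE[OF e] by blast
    then show ?thesis by simp
  qed
  ultimately have "\<exists>T w. finite T \<and> (\<forall>t\<in>T. t \<ge> 0 \<and> w t \<ge> 0) \<and>
    (\<forall>i. (\<Sum>t\<in>T. w t * t ^ e i) = (fact (e i) :: real)) \<and> sum w T = 1"
    by (rule factorial_moments)
  then obtain T w where T: "finite T" "\<And>t. t \<in> T \<Longrightarrow> t \<ge> 0" "\<And>t. t \<in> T \<Longrightarrow> w t \<ge> 0"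
    "\<And>i. (\<Sum>t\<in>T. w t * t ^ e i) = fact (e i)" "sum w T = (1 :: real)"
    by blast
  have mom: "(\<Sum>t\<in>T. w t * t ^ p) = fact p" if "p < N" for p
  proof (cases p)
    case 0
    then show ?thesis using T(5) by simp
  next
    case (Suc m)
    then have "p \<in> e ` UNIV" using that e by (auto simp: bij_betw_def N_def)
    then show ?thesis using T(4) by auto
  qed
  define \<omega> where "\<omega> = cis (2 * pi / real N)"
  show ?thesis
  proof (intro exI[of _ "T \<times> {..<N}"] exI[of _ "\<lambda>(t, j). w t / N"]
      exI[of _ "\<lambda>(t, j). of_real (sqrt t) * \<omega> ^ j"] conjI allI impI)
    fix p q
    assume "p \<le> Suc CARD('n)" "q \<le> Suc CARD('n)"
    then have pq: "p < N" "q < N" by (auto simp: N_def)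
    have "(\<Sum>x\<in>T \<times> {..<N}. complex_of_real (case x of (t, j) \<Rightarrow> w t / N) *
        ((case x of (t, j) \<Rightarrow> of_real (sqrt t) * \<omega> ^ j) ^ p * cnj (case x of (t, j) \<Rightarrow> of_real (sqrt t) * \<omega> ^ j) ^ q))
      = (\<Sum>t\<in>T. of_real (w t / N * sqrt t ^ (p + q)) * (\<Sum>j<N. (\<omega> ^ j) ^ p * cnj (\<omega> ^ j) ^ q))"
      unfolding sum.cartesian_product' by (simp add: sum_distrib_left sum_divide_distrib power_mult_distrib power_add mult_ac)
    also have "\<dots> = (if p = q then fact p else 0)"
    proof (cases "p = q")
      case True
      have "(\<Sum>t\<in>T. complex_of_real (w t / N * sqrt t ^ (p + q)) * of_nat N) = of_real (\<Sum>t\<in>T. w t * t ^ p)"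
        unfolding of_real_sum
      proof (rule sum.cong[OF refl])
        fix t assume "t \<in> T"
        have "sqrt t ^ (p + q) = t ^ p"
          using True T(2)[OF \<open>t \<in> T\<close>] by (simp add: power_add flip: power_mult_distrib)
        then show "complex_of_real (w t / N * sqrt t ^ (p + q)) * of_nat N = of_real (w t * t ^ p)"
          by (simp add: N_def del: of_nat_Suc)
      qed
      also have "\<dots> = fact p" unfolding mom[OF pq(1)] by simp
      finally show ?thesis
        unfolding \<omega>_def sum_roots_of_unity[OF pq] if_P[OF True] .
    next
      case False
      then show ?thesis unfolding \<omega>_def sum_roots_of_unity[OF pq] by simp
    qed
    finally show "(\<Sum>x\<in>T \<times> {..<N}. complex_of_real (case x of (t, j) \<Rightarrow> w t / N) *
        ((case x of (t, j) \<Rightarrow> of_real (sqrt t) * \<omega> ^ j) ^ p * cnj (case x of (t, j) \<Rightarrow> of_real (sqrt t) * \<omega> ^ j) ^ q))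
      = (if p = q then fact p else 0)" .
  qed (use T in auto)
qed

section \<open>Functions with prescribed multiset of values\<close>

abbreviation range_mset :: "('n::finite \<Rightarrow> 'b) \<Rightarrow> 'b multiset" where
  "range_mset g \<equiv> image_mset g (mset_set UNIV)"

lemma count_range_mset: "count (range_mset g) b = card {i. g i = b}"
  by (simp add: count_image_mset vimage_def)

text \<open>Listing the elements of \<open>'n\<close> turns such functions into arrangements of
  \<open>M\<close>, which the multinomial coefficient counts; the product form avoids a
  division.\<close>

lemma card_range_mset_eq:
  fixes M :: "'b multiset"
  assumes "size M = CARD('n::finite)"
  shows "card {g :: 'n \<Rightarrow> 'b. range_mset g = M} * (\<Prod>c\<in>set_mset M. fact (count M c)) = fact CARD('n)"
proof -
  obtain es :: "'n list" where es: "set es = UNIV" "distinct es"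
    using finite_distinct_list[OF finite_class.finite_UNIV] by blast
  have mset_es: "mset (map g es) = range_mset g" for g :: "'n \<Rightarrow> 'b"
    using mset_set_set[OF es(2)] es(1) by simp
  have len: "length es = CARD('n)" using distinct_card[OF es(2)] es(1) by simp
  have "bij_betw (\<lambda>g. map g es) {g. range_mset g = M} (permutations_of_multiset M)"
  proof (rule bij_betwI')
    fix g h :: "'n \<Rightarrow> 'b"
    show "(map g es = map h es) = (g = h)" using es by (auto simp: map_eq_conv)
  next
    fix g :: "'n \<Rightarrow> 'b" assume "g \<in> {g. range_mset g = M}"
    then show "map g es \<in> permutations_of_multiset M"
      using mset_es[of g] by (simp add: permutations_of_multiset_def)
  next
    fix xs assume xs: "xs \<in> permutations_of_multiset M"
    then have "length xs = length es"
      using assms len permutations_of_multisetD[OF xs] by auto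
    define g where "g i = the (map_of (zip es xs) i)" for i
    have "map g es = xs"
    proof (rule nth_equalityI)
      fix j assume "j < length (map g es)"
      then show "map g es ! j = xs ! j"
        using \<open>length xs = length es\<close> es by (simp add: g_def map_of_zip_nth)
    qed (simp add: \<open>length xs = length es\<close>)
    then show "\<exists>g\<in>{g. range_mset g = M}. xs = map g es"
      using permutations_of_multisetD[OF xs] mset_es[of g] by (intro bexI[of _ g]) auto
  qed
  then have "card {g :: 'n \<Rightarrow> 'b. range_mset g = M} = card (permutations_of_multiset M)"
    by (rule bij_betw_same_card)
  then show ?thesis using card_permutations_of_multiset_aux[of M] assms by simp
qed

lemma prod_fact_count:
  fixes M :: "'b::finite multiset"
  shows "(\<Prod>c\<in>set_mset M. fact (count M c)) = (\<Prod>c\<in>UNIV. fact (count M c))"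
  by (rule prod.mono_neutral_left) (auto simp: not_in_iff)

text \<open>Wick's formula contracted with a permutation-invariant function: the factorials cancel
  against the number of functions with a prescribed multiset of values.\<close>

lemma sum_permutation_invariant:
  fixes F :: "('n::finite \<Rightarrow> 'b::finite) \<Rightarrow> complex" and g :: "'n \<Rightarrow> 'b" and b b' :: 'b
  assumes inv: "\<And>h \<pi>. bij \<pi> \<Longrightarrow> F (h \<circ> \<pi>) = F h"
  defines "M \<equiv> add_mset b' (range_mset g)"
  shows "(\<Sum>h\<in>UNIV. F h * (if add_mset b (range_mset h) = M then of_nat (\<Prod>c\<in>UNIV. fact (count M c)) else 0))
    = fact CARD('n) * ((if b = b' then F g else 0) + (\<Sum>i | g i = b. F (g(i := b'))))"
proof -
  have cong: "F h = F h'" if eq: "range_mset h = range_mset h'" for h h'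
  proof -
    obtain \<pi> where \<pi>: "\<pi> permutes UNIV" "\<forall>x\<in>UNIV. h x = h' (\<pi> x)"
      using image_mset_eq_implies_permutes[OF finite_class.finite_UNIV eq] by blast
    then have "h = h' \<circ> \<pi>" by auto
    then show ?thesis using inv[of \<pi> h'] \<pi>(1) by (simp add: permutes_bij)
  qed
  show ?thesis
  proof (cases "b \<in># M")
    case False
    then have "add_mset b (range_mset h) \<noteq> M" for h :: "'n \<Rightarrow> 'b" by auto
    moreover have "b \<noteq> b'" "\<And>i. g i \<noteq> b" using False by (auto simp: M_def)
    ultimately show ?thesis by simp
  next
    case True
    define K where "K = M - {#b#}"
    have M: "M = add_mset b K" using True by (simp add: K_def)
    have "size M = Suc CARD('n)" by (simp add: M_def)
    then have sizeK: "size K = CARD('n)" by (simp add: M)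
    have eqK: "add_mset b (range_mset h) = M \<longleftrightarrow> range_mset h = K" for h :: "'n \<Rightarrow> 'b"
      by (simp add: M)
    obtain h0 :: "'n \<Rightarrow> 'b" where h0: "range_mset h0 = K"
    proof -
      have "card {h :: 'n \<Rightarrow> 'b. range_mset h = K} \<noteq> 0"
        using card_range_mset_eq[OF sizeK] by (metis fact_nonzero mult_zero_left)
      then show thesis using that by (metis (mono_tags, lifting) Collect_empty_eq card.empty)
    qed
    have prodM: "(\<Prod>c\<in>UNIV. fact (count M c)) = count M b * (\<Prod>c\<in>UNIV. fact (count K c) :: nat)"
    proof -
      have "(\<Prod>c\<in>UNIV. fact (count M c)) = fact (count M b) * (\<Prod>c\<in>UNIV - {b}. fact (count M c) :: nat)"
        by (simp add: prod.remove)
      also have "(\<Prod>c\<in>UNIV - {b}. fact (count M c)) = (\<Prod>c\<in>UNIV - {b}. fact (count K c) :: nat)"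
        by (intro prod.cong) (auto simp: M)
      also have "fact (count M b) = count M b * (fact (count K b) :: nat)" by (simp add: M)
      finally show ?thesis by (simp add: prod.remove[of UNIV b])
    qed
    have "(\<Sum>h\<in>UNIV. F h * (if add_mset b (range_mset h) = M then of_nat (\<Prod>c\<in>UNIV. fact (count M c)) else 0))
        = (\<Sum>h\<in>{h :: 'n \<Rightarrow> 'b. range_mset h = K}. F h0 * of_nat (\<Prod>c\<in>UNIV. fact (count M c)))"
      unfolding eqK
    proof (rule sum.mono_neutral_cong_right)
      fix h assume "h \<in> {h :: 'n \<Rightarrow> 'b. range_mset h = K}"
      then have "range_mset h = K" "F h = F h0" using cong[of h h0] h0 by auto
      then show "F h * (if range_mset h = K then of_nat (\<Prod>c\<in>UNIV. fact (count M c)) else 0)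
          = F h0 * of_nat (\<Prod>c\<in>UNIV. fact (count M c))"
        by simp
    qed auto
    also have "\<dots> = F h0 * of_nat (count M b * (card {h :: 'n \<Rightarrow> 'b. range_mset h = K} * (\<Prod>c\<in>set_mset K. fact (count K c))))"
      unfolding prodM prod_fact_count by (simp del: of_nat_prod)
    also have "\<dots> = fact CARD('n) * (of_nat (count M b) * F h0)"
      unfolding card_range_mset_eq[OF sizeK] by simp
    \<comment> \<open>Each occurrence of \<open>b\<close> in \<open>M\<close> is either the added
      \<open>b'\<close> or a position \<open>i\<close> with \<open>g i = b\<close>. Removing it
      leaves the multiset \<open>K\<close>, realised by \<open>g\<close> or by
      \<open>g(i := b')\<close>, where \<open>F\<close> has the value \<open>F h0\<close>.\<close>
    also have "of_nat (count M b) * F h0 = (if b = b' then F g else 0) + (\<Sum>i | g i = b. F (g(i := b')))"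
    proof -
      have "(\<Sum>i | g i = b. F (g(i := b'))) = (\<Sum>i | g i = b. F h0)"
      proof (rule sum.cong[OF refl])
        fix i assume "i \<in> {i. g i = b}"
        then have i: "g i = b" by simp
        have ms: "range_mset f = add_mset (f i) (image_mset f (mset_set (UNIV - {i})))" for f :: "'n \<Rightarrow> 'b"
          using mset_set.remove[of UNIV i] by simp
        have "image_mset (g(i := b')) (mset_set (UNIV - {i})) = image_mset g (mset_set (UNIV - {i}))"
          by (intro image_mset_cong) auto
        then have "add_mset b (range_mset (g(i := b'))) = M"
          unfolding M_def ms[of g] ms[of "g(i := b')"] using i by (simp add: add_mset_commute)
        then show "F (g(i := b')) = F h0" using cong h0 eqK by metis
      qed
      moreover have "(if b = b' then F g else 0) = (if b = b' then F h0 else 0)"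
      proof (cases "b = b'")
        case True
        then have "range_mset g = K" by (simp add: K_def M_def)
        then show ?thesis using cong h0 by metis
      qed simp
      ultimately show ?thesis by (simp add: M_def count_range_mset algebra_simps)
    qed
    finally show ?thesis .
  qed
qed

lemma prod_range_mset:
  fixes f :: "'b::finite \<Rightarrow> 'c::comm_monoid_mult" and g :: "'n::finite \<Rightarrow> 'b"
  shows "(\<Prod>i\<in>UNIV. f (g i)) = (\<Prod>c\<in>UNIV. f c ^ count (range_mset g) c)"
proof -
  have "(\<Prod>i\<in>UNIV. f (g i)) = (\<Prod>c\<in>UNIV. \<Prod>i | i \<in> UNIV \<and> g i = c. f (g i))"
    by (rule prod.group[symmetric]) auto
  then show ?thesis by (simp add: count_range_mset)
qed

text \<open>A finitely supported stand-in for the Gaussian measure on \<open>complex ^ 'b\<close>, exact on all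
  monomials of degree at most \<open>CARD('n) + 1\<close>.\<close>

lemma gaussian_vector_quadrature:
  "\<exists>(X :: ('b::finite \<Rightarrow> real \<times> nat) set) W \<psi>. finite X \<and> (\<forall>x\<in>X. W x \<ge> 0) \<and>
    (\<forall>(g :: 'n::finite \<Rightarrow> 'b) (h :: 'n \<Rightarrow> 'b) b b'.
      (\<Sum>x\<in>X. complex_of_real (W x) *
        (\<psi> x b * cnj (\<psi> x b') * ((\<Prod>i\<in>UNIV. \<psi> x (h i)) * cnj (\<Prod>i\<in>UNIV. \<psi> x (g i)))))
      = (if add_mset b (range_mset h) = add_mset b' (range_mset g)
         then of_nat (\<Prod>c\<in>UNIV. fact (count (add_mset b' (range_mset g)) c)) else 0))"
proof -
  obtain I :: "(real \<times> nat) set" and z w where I: "finite I" "\<And>x. x \<in> I \<Longrightarrow> w x \<ge> 0"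
    "\<And>p q. p \<le> Suc CARD('n) \<Longrightarrow> q \<le> Suc CARD('n) \<Longrightarrow>
      (\<Sum>x\<in>I. complex_of_real (w x) * (z x ^ p * cnj (z x) ^ q)) = (if p = q then fact p else 0)"
    using gaussian_moments_quadrature[where 'n = 'n] by blast
  show ?thesis
  proof (intro exI[of _ "PiE UNIV (\<lambda>_. I)"] exI[of _ "\<lambda>x. \<Prod>c\<in>UNIV. w (x c)"]
      exI[of _ "\<lambda>x c. z (x c)"] conjI allI)
    fix g h :: "'n \<Rightarrow> 'b" and b b' :: 'b
    let ?M = "add_mset b' (range_mset g)" and ?M' = "add_mset b (range_mset h)"
    \<comment> \<open>Each multiset has \<open>CARD('n) + 1\<close> elements, so no coordinate gets
      an exponent beyond the reach of the one-variable quadrature.\<close>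
    have le: "count ?M c \<le> Suc CARD('n)" "count ?M' c \<le> Suc CARD('n)" for c
      using count_le_size[of ?M c] count_le_size[of ?M' c] by auto
    have mono: "y b * (\<Prod>i\<in>UNIV. y (h i)) = (\<Prod>c\<in>UNIV. y c ^ count (add_mset b (range_mset h)) c)"
      for y :: "'b \<Rightarrow> complex" and b and h :: "'n \<Rightarrow> 'b"
    proof -
      have "(\<Prod>c\<in>UNIV. y c ^ count (add_mset b (range_mset h)) c)
          = (\<Prod>c\<in>UNIV. (if c = b then y c else 1) * y c ^ count (range_mset h) c)"
        by (intro prod.cong) auto
      then show ?thesis by (simp add: prod.distrib prod_range_mset)
    qed
    have "(\<Sum>x\<in>PiE UNIV (\<lambda>_. I). of_real (\<Prod>c\<in>UNIV. w (x c)) *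
          (z (x b) * cnj (z (x b')) * ((\<Prod>i\<in>UNIV. z (x (h i))) * cnj (\<Prod>i\<in>UNIV. z (x (g i))))))
      = (\<Sum>x\<in>PiE UNIV (\<lambda>_. I). \<Prod>c\<in>UNIV. of_real (w (x c)) * (z (x c) ^ count ?M' c * cnj (z (x c)) ^ count ?M c))"
    proof (rule sum.cong[OF refl])
      fix x
      have "of_real (\<Prod>c\<in>UNIV. w (x c)) *
          (z (x b) * cnj (z (x b')) * ((\<Prod>i\<in>UNIV. z (x (h i))) * cnj (\<Prod>i\<in>UNIV. z (x (g i)))))
        = of_real (\<Prod>c\<in>UNIV. w (x c)) * ((z (x b) * (\<Prod>i\<in>UNIV. z (x (h i)))) *
          (cnj (z (x b')) * (\<Prod>i\<in>UNIV. cnj (z (x (g i))))))"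
        by (simp add: mult_ac)
      then show "of_real (\<Prod>c\<in>UNIV. w (x c)) *
          (z (x b) * cnj (z (x b')) * ((\<Prod>i\<in>UNIV. z (x (h i))) * cnj (\<Prod>i\<in>UNIV. z (x (g i)))))
        = (\<Prod>c\<in>UNIV. of_real (w (x c)) * (z (x c) ^ count ?M' c * cnj (z (x c)) ^ count ?M c))"
        unfolding mono[of "\<lambda>c. z (x c)"] mono[of "\<lambda>c. cnj (z (x c))"] prod.distrib of_real_prod .
    qed
    \<comment> \<open>Independence of the coordinates: the sum over the product grid of nodes
      factorises.\<close>
    also have "\<dots> = (\<Prod>c\<in>UNIV. \<Sum>x\<in>I. of_real (w x) * (z x ^ count ?M' c * cnj (z x) ^ count ?M c))"
      by (rule prod_sum_PiE[symmetric]) (auto simp: I)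
    also have "\<dots> = (\<Prod>c\<in>UNIV. if count ?M' c = count ?M c then fact (count ?M' c) else 0)"
      using le by (intro prod.cong refl I(3))
    also have "\<dots> = (if ?M' = ?M then of_nat (\<Prod>c\<in>UNIV. fact (count ?M c)) else 0)"
    proof (cases "?M' = ?M")
      case False
      then obtain c where c: "count ?M' c \<noteq> count ?M c" by (meson multiset_eqI)
      have "(\<Prod>c\<in>UNIV. if count ?M' c = count ?M c then fact (count ?M' c) else 0) = (0 :: complex)"
        by (rule prod_zero[OF finite_class.finite_UNIV], rule bexI[of _ c]) (simp_all only: c if_False UNIV_I)
      then show ?thesis using False by (simp only: if_False)
    qed simp
    finally show "(\<Sum>x\<in>PiE UNIV (\<lambda>_. I). of_real (\<Prod>c\<in>UNIV. w (x c)) *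
          (z (x b) * cnj (z (x b')) * ((\<Prod>i\<in>UNIV. z (x (h i))) * cnj (\<Prod>i\<in>UNIV. z (x (g i))))))
      = (if ?M' = ?M then of_nat (\<Prod>c\<in>UNIV. fact (count ?M c)) else 0)" .
  qed (auto simp: I PiE_mem intro!: finite_PiE prod_nonneg I(2))
qed

section \<open>Separable states\<close>

lemma sum_UNIV_prod: "(\<Sum>x\<in>UNIV. f x) = (\<Sum>a\<in>UNIV. \<Sum>b\<in>UNIV. f (a, b))"
  unfolding UNIV_Times_UNIV[symmetric] sum.cartesian_product' ..

lemma positive_op_scaleR:
  assumes "positive_op M" "r \<ge> 0"
  shows "positive_op (r *\<^sub>R M)"
proof -
  have "cdot v ((r *\<^sub>R M) *v v) = of_real r * cdot v (M *v v)" for v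
    by (simp add: cdot_def matrix_vector_mult_def sum_distrib_left scaleR_conv_of_real[where 'a = complex] mult_ac)
  then show ?thesis using assms by (simp add: positive_op_cdot)
qed

lemma trace_scaleR: "trace (r *\<^sub>R M :: 'i::finite op) = of_real r * trace M"
  by (simp add: trace_def sum_distrib_left scaleR_conv_of_real[where 'a = complex])

lemma trace_tensor_op: "trace (tensor_op A B) = trace A * trace B"
  by (simp add: trace_def tensor_op_def sum_product sum_UNIV_prod)

lemma positive_op_trace:
  assumes "positive_op M"
  shows "trace M = of_real (Re (trace M))" and "Re (trace M) \<ge> 0"
proof -
  have "M $ i $ i \<in> \<real>\<^sub>\<ge>\<^sub>0" for i
    using assms by (metis cdot_axis_axis positive_op_cdot)
  then have "Im (M $ i $ i) = 0" "Re (M $ i $ i) \<ge> 0" for i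
    by (auto simp: complex_nonneg_Reals_iff)
  then show "trace M = of_real (Re (trace M))" "Re (trace M) \<ge> 0"
    by (auto simp: trace_def complex_eq_iff sum_nonneg)
qed

lemma positive_op_mat_1: "positive_op (mat 1)"
  by (rule positive_op_gram[where X = UNIV and y = "\<lambda>k p. if k = p then 1 else 0"])
     (simp add: mat_def if_distrib[of cnj] if_distrib[of "\<lambda>x. x * _"] cong: if_cong)

lemma trace_mat_1: "trace (mat 1 :: 'i::finite op) = of_nat CARD('i)"
  by (simp add: trace_def mat_def)

lemma positive_op_tensor:
  assumes "positive_op (A :: 'i::finite op)" "positive_op (B :: 'j::finite op)"
  shows "positive_op (tensor_op A B)"
proof -
  obtain y :: "'i \<Rightarrow> 'i \<Rightarrow> complex" where y: "\<And>p q. A $ p $ q = (\<Sum>x\<in>UNIV. y x p * cnj (y x q))"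
    using positive_op_imp_gram[OF assms(1)] by blast
  obtain z :: "'j \<Rightarrow> 'j \<Rightarrow> complex" where z: "\<And>p q. B $ p $ q = (\<Sum>x\<in>UNIV. z x p * cnj (z x q))"
    using positive_op_imp_gram[OF assms(2)] by blast
  show ?thesis
    by (rule positive_op_gram[where X = UNIV and y = "\<lambda>x p. y (fst x) (fst p) * z (snd x) (snd p)"])
       (simp add: tensor_op_def y z sum_product sum_UNIV_prod mult_ac)
qed

lemma state_normalize:
  assumes "positive_op M" "trace M \<noteq> 0"
  shows "state ((1 / Re (trace M)) *\<^sub>R M)"
proof -
  have "Re (trace M) \<noteq> 0" using positive_op_trace(1)[OF assms(1)] assms(2) by (metis of_real_0)
  then have "trace ((1 / Re (trace M)) *\<^sub>R M) = 1"
    unfolding trace_scaleR by (subst (2) positive_op_trace(1)[OF assms(1)]) simp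
  then show ?thesis
    using positive_op_scaleR[OF assms(1)] positive_op_trace(2)[OF assms(1)] by (simp add: state_def)
qed

lemma tensor_op_scaleR: "tensor_op (r *\<^sub>R A) (s *\<^sub>R B) = (r * s) *\<^sub>R tensor_op A B"
  by (simp add: tensor_op_def vec_eq_iff scaleR_conv_of_real[where 'a = complex] mult_ac)

lemma product_state_in_SEP: "state \<rho> \<Longrightarrow> state \<sigma> \<Longrightarrow> tensor_op \<rho> \<sigma> \<in> SEP"
  unfolding SEP_def by (rule hull_inc) blast

lemma tensor_positive_in_cone_SEP:
  assumes A: "positive_op (A :: 'a::finite op)" and B: "positive_op (B :: 'b::finite op)"
  shows "\<exists>s\<in>SEP. tensor_op A B = (Re (trace A) * Re (trace B)) *\<^sub>R s"
proof (cases "trace A = 0 \<or> trace B = 0")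
  case True
  have nz: "trace (mat 1 :: 'a op) \<noteq> 0" "trace (mat 1 :: 'b op) \<noteq> 0"
    by (simp_all add: trace_mat_1)
  \<comment> \<open>With coefficient 0 any separable state will do; the product of the maximally
    mixed states is one.\<close>
  have "tensor_op ((1 / Re (trace (mat 1 :: 'a op))) *\<^sub>R (mat 1 :: 'a op))
      ((1 / Re (trace (mat 1 :: 'b op))) *\<^sub>R (mat 1 :: 'b op)) \<in> SEP"
    by (intro product_state_in_SEP state_normalize positive_op_mat_1 nz)
  moreover have "tensor_op A B = 0"
    using True positive_op_trace_0[OF A] positive_op_trace_0[OF B]
    by (auto simp: tensor_op_def vec_eq_iff)
  ultimately show ?thesis using True by (metis mult_zero_left mult_zero_right scaleR_zero_left zero_complex.sel(1))
next
  case False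
  then have nz: "trace A \<noteq> 0" "trace B \<noteq> 0" by auto
  then have "Re (trace A) \<noteq> 0" "Re (trace B) \<noteq> 0"
    using positive_op_trace(1)[OF A] positive_op_trace(1)[OF B] by (metis of_real_0)+
  then have "tensor_op A B = (Re (trace A) * Re (trace B)) *\<^sub>R
      tensor_op ((1 / Re (trace A)) *\<^sub>R A) ((1 / Re (trace B)) *\<^sub>R B)"
    by (simp add: tensor_op_scaleR)
  then show ?thesis
    using product_state_in_SEP[OF state_normalize[OF A nz(1)] state_normalize[OF B nz(2)]] by blast
qed

lemma trace_sum: "trace (\<Sum>x\<in>X. f x) = (\<Sum>x\<in>X. trace (f x))"
  unfolding trace_def by (simp add: sum.swap[of _ X])

text \<open>The coefficient \<open>c x\<close> is the trace of its summand, so total trace 1 is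
  exactly the condition for a convex combination, and no factor has to be normalised
  beforehand.\<close>

lemma sum_tensor_in_SEP:
  assumes "finite X" and W: "\<And>x. x \<in> X \<Longrightarrow> W x \<ge> 0"
    and A: "\<And>x. x \<in> X \<Longrightarrow> positive_op (A x)" and B: "\<And>x. x \<in> X \<Longrightarrow> positive_op (B x)"
    and tr: "trace (\<Sum>x\<in>X. W x *\<^sub>R tensor_op (A x) (B x)) = 1"
  shows "(\<Sum>x\<in>X. W x *\<^sub>R tensor_op (A x) (B x)) \<in> SEP"
proof -
  define c where "c x = W x * (Re (trace (A x)) * Re (trace (B x)))" for x
  have "\<forall>x\<in>X. \<exists>s. s \<in> SEP \<and> tensor_op (A x) (B x) = (Re (trace (A x)) * Re (trace (B x))) *\<^sub>R s"
    using tensor_positive_in_cone_SEP A B by blast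
  then obtain s where s: "\<And>x. x \<in> X \<Longrightarrow> s x \<in> SEP"
    "\<And>x. x \<in> X \<Longrightarrow> tensor_op (A x) (B x) = (Re (trace (A x)) * Re (trace (B x))) *\<^sub>R s x"
    by metis
  have eq: "(\<Sum>x\<in>X. W x *\<^sub>R tensor_op (A x) (B x)) = (\<Sum>x\<in>X. c x *\<^sub>R s x)"
    by (intro sum.cong) (simp_all add: s c_def)
  have "trace (W x *\<^sub>R tensor_op (A x) (B x)) = of_real (c x)" if "x \<in> X" for x
    using positive_op_trace(1)[OF A[OF that]] positive_op_trace(1)[OF B[OF that]]
    unfolding trace_scaleR trace_tensor_op c_def of_real_mult by simp
  then have "of_real (\<Sum>x\<in>X. c x) = (1 :: complex)"
    using tr unfolding trace_sum by simp
  then have "(\<Sum>x\<in>X. c x) = 1" by (metis of_real_eq_1_iff)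
  moreover have "c x \<ge> 0" if "x \<in> X" for x
    using W A B that by (simp add: c_def positive_op_trace(2))
  ultimately show ?thesis
    unfolding eq using s(1) \<open>finite X\<close> by (intro convex_sum) (auto simp: SEP_def)
qed

section \<open>Partial traces and partial contractions\<close>

definition marginal :: "'n::finite \<Rightarrow> ('n \<Rightarrow> 'a::finite) op \<Rightarrow> 'a op" where
  "marginal k N = (\<chi> a a'. \<Sum>f | f k = a. N $ f $ f(k := a'))"

text \<open>Moves \<open>a\<close> from the index set into the summand: a Gram decomposition needs
  an index set common to all rows and columns. The value \<open>a0\<close> is an arbitrary
  placeholder.\<close>

lemma sum_fixed_coordinate:
  "(\<Sum>f | f k = a. G f) = (\<Sum>f | f k = a0. G (f(k := a)))"
  by (rule sum.reindex_bij_witness[of _ "\<lambda>f. f(k := a)" "\<lambda>f. f(k := a0)"]) auto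

lemma positive_op_marginal:
  fixes N :: "('n::finite \<Rightarrow> 'a::finite) op"
  assumes "positive_op N"
  shows "positive_op (marginal k N)"
proof -
  obtain y :: "('n \<Rightarrow> 'a) \<Rightarrow> ('n \<Rightarrow> 'a) \<Rightarrow> complex"
    where y: "\<And>p q. N $ p $ q = (\<Sum>x\<in>UNIV. y x p * cnj (y x q))"
    using positive_op_imp_gram[OF assms] by blast
  show ?thesis
  proof (rule positive_op_gram)
    fix a a'
    show "marginal k N $ a $ a' = (\<Sum>x\<in>{f. f k = undefined} \<times> UNIV.
        y (snd x) ((fst x)(k := a)) * cnj (y (snd x) ((fst x)(k := a'))))"
      unfolding marginal_def sum.cartesian_product' y
      by (simp, subst sum_fixed_coordinate[where ?a0.0 = undefined]) simp
  qed
qed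

lemma trace_marginal: "trace (marginal k N) = trace N"
proof -
  have "trace (marginal k N) = (\<Sum>a\<in>UNIV. \<Sum>f | f \<in> UNIV \<and> f k = a. N $ f $ f)"
    unfolding trace_def marginal_def by (auto intro!: sum.cong)
  also have "\<dots> = trace N"
    unfolding trace_def by (rule sum.group) auto
  finally show ?thesis .
qed

text \<open>The unnormalised state left on the first system when the second is projected onto
  \<open>\<Phi>\<close>.\<close>

definition contraction_B :: "('j::finite \<Rightarrow> complex) \<Rightarrow> ('i::finite \<times> 'j) op \<Rightarrow> 'i op" where
  "contraction_B \<Phi> R = (\<chi> f f'. \<Sum>g\<in>UNIV. \<Sum>h\<in>UNIV. cnj (\<Phi> g) * R $ (f, g) $ (f', h) * \<Phi> h)"

lemma positive_op_contraction_B: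
  fixes R :: "('i::finite \<times> 'j::finite) op"
  assumes "positive_op R"
  shows "positive_op (contraction_B \<Phi> R)"
proof -
  obtain y :: "'i \<times> 'j \<Rightarrow> 'i \<times> 'j \<Rightarrow> complex"
    where y: "\<And>p q. R $ p $ q = (\<Sum>x\<in>UNIV. y x p * cnj (y x q))"
    using positive_op_imp_gram[OF assms] by blast
  show ?thesis
  proof (rule positive_op_gram)
    fix f f'
    let ?t = "\<lambda>x g h. (cnj (\<Phi> g) * y x (f, g)) * cnj (cnj (\<Phi> h) * y x (f', h))"
    have "contraction_B \<Phi> R $ f $ f' = (\<Sum>g\<in>UNIV. \<Sum>h\<in>UNIV. \<Sum>x\<in>UNIV. ?t x g h)"
      by (simp add: contraction_B_def y sum_distrib_left sum_distrib_right mult_ac)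
    also have "\<dots> = (\<Sum>g\<in>UNIV. \<Sum>x\<in>UNIV. \<Sum>h\<in>UNIV. ?t x g h)"
      by (intro sum.cong refl sum.swap)
    also have "\<dots> = (\<Sum>x\<in>UNIV. \<Sum>g\<in>UNIV. \<Sum>h\<in>UNIV. ?t x g h)"
      by (rule sum.swap)
    finally show "contraction_B \<Phi> R $ f $ f' = (\<Sum>x\<in>UNIV. (\<Sum>g\<in>UNIV. cnj (\<Phi> g) * y x (f, g)) *
        cnj (\<Sum>g\<in>UNIV. cnj (\<Phi> g) * y x (f', g)))"
      by (simp only: sum_product cnj_sum)
  qed
qed

definition trace_B :: "('i::finite \<times> 'j::finite) op \<Rightarrow> 'i op" where
  "trace_B R = (\<chi> f f'. \<Sum>g\<in>UNIV. R $ (f, g) $ (f', g))"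

lemma positive_op_trace_B:
  fixes R :: "('i::finite \<times> 'j::finite) op"
  assumes "positive_op R"
  shows "positive_op (trace_B R)"
proof -
  obtain y :: "'i \<times> 'j \<Rightarrow> 'i \<times> 'j \<Rightarrow> complex"
    where y: "\<And>p q. R $ p $ q = (\<Sum>x\<in>UNIV. y x p * cnj (y x q))"
    using positive_op_imp_gram[OF assms] by blast
  show ?thesis
    by (rule positive_op_gram[where X = UNIV and y = "\<lambda>x f. y (snd x) (f, fst x)"])
       (simp add: trace_B_def y sum_UNIV_prod)
qed

lemma trace_trace_B: "trace (trace_B R) = trace R"
  by (simp add: trace_def trace_B_def sum_UNIV_prod)

section \<open>The measure-and-prepare identity\<close>

lemma bose_symmetric_B_row:
  fixes R :: "('i::finite \<times> ('n::finite \<Rightarrow> 'b::finite)) op"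
  assumes "bose_symmetric_B R" "bij \<pi>"
  shows "R $ (f, g \<circ> \<pi>) $ q = R $ (f, g) $ q"
proof -
  have "(tensor_op (mat 1) (perm_op \<pi>) ** R) $ (f, g) $ q
      = (\<Sum>f'\<in>UNIV. \<Sum>g'\<in>UNIV. (if f = f' then 1 else 0) * (if g = g' \<circ> inv \<pi> then 1 else 0) * R $ (f', g') $ q)"
    by (simp add: matrix_matrix_mult_def tensor_op_def mat_def perm_op_def sum_UNIV_prod)
  also have "\<dots> = (\<Sum>f'\<in>UNIV. \<Sum>g'\<in>UNIV. if f' = f \<and> g' = g \<circ> \<pi> then R $ (f', g') $ q else 0)"
  proof (intro sum.cong refl)
    fix f' and g' :: "'n \<Rightarrow> 'b"
    have "g = g' \<circ> inv \<pi> \<longleftrightarrow> g' = g \<circ> \<pi>"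
      using assms(2) by (metis bij_is_inj bij_is_surj comp_assoc comp_id inj_iff surj_iff)
    then show "(if f = f' then 1 else 0) * (if g = g' \<circ> inv \<pi> then 1 else 0) * R $ (f', g') $ q
        = (if f' = f \<and> g' = g \<circ> \<pi> then R $ (f', g') $ q else 0)" by auto
  qed
  also have "\<dots> = (\<Sum>f'\<in>UNIV. if f' = f then (\<Sum>g'\<in>UNIV. if g' = g \<circ> \<pi> then R $ (f', g') $ q else 0) else 0)"
    by (intro sum.cong refl) auto
  also have "\<dots> = R $ (f, g \<circ> \<pi>) $ q" by simp
  finally show ?thesis using assms by (simp add: bose_symmetric_B_def)
qed

text \<open>Bose symmetry speaks of multiplication from the left, hence of rows; Hermiticity carries
  it over to columns.\<close>

lemma bose_symmetric_B_column:
  assumes "bose_symmetric_B R" "positive_op R" "bij \<pi>"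
  shows "R $ p $ (f, g \<circ> \<pi>) = R $ p $ (f, g)"
proof -
  have "R $ p $ q = cnj (R $ q $ p)" for q
    using positive_op_hermitian[OF assms(2)] by (metis (no_types, lifting) dagger_def vec_lambda_beta)
  then show ?thesis using bose_symmetric_B_row[OF assms(1,3)] by metis
qed

text \<open>Transposing \<open>i\<close> and \<open>k\<close> in row and column alike leaves the
  entries unchanged. Hence all \<open>CARD('n)\<close> positions contribute the same reduced
  operator.\<close>

lemma sum_replace_coordinate_eq:
  assumes "bose_symmetric_B R" "positive_op R"
  shows "(\<Sum>g | g i = b. R $ (f, g) $ (f', g(i := b'))) = (\<Sum>g | g k = b. R $ (f, g) $ (f', g(k := b')))"
proof (rule sum.reindex_bij_witness[of _ "\<lambda>g. g \<circ> Transposition.transpose i k" "\<lambda>g. g \<circ> Transposition.transpose i k"])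
  fix g assume "g \<in> {g. g i = b}"
  have "(g \<circ> Transposition.transpose i k)(k := b') = g(i := b') \<circ> Transposition.transpose i k"
    by (auto simp: fun_eq_iff Transposition.transpose_def)
  then show "R $ (f, g \<circ> Transposition.transpose i k) $ (f', (g \<circ> Transposition.transpose i k)(k := b')) = R $ (f, g) $ (f', g(i := b'))"
    using bose_symmetric_B_row[OF assms(1)] bose_symmetric_B_column[OF assms] by simp
qed (auto simp: comp_assoc)

lemma trace_reduced_op: "trace (reduced_op k R) = trace R"
proof -
  have "trace (reduced_op k R)
      = (\<Sum>a\<in>UNIV. \<Sum>b\<in>UNIV. \<Sum>f | f k = a. \<Sum>g | g k = b. R $ (f, g) $ (f, g))"
    by (auto simp: trace_def reduced_op_def sum_UNIV_prod intro!: sum.cong)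
  also have "\<dots> = (\<Sum>a\<in>UNIV. \<Sum>f | f \<in> UNIV \<and> f k = a. \<Sum>b\<in>UNIV. \<Sum>g | g \<in> UNIV \<and> g k = b. R $ (f, g) $ (f, g))"
    by (simp, intro sum.cong refl sum.swap)
  also have "\<dots> = (\<Sum>a\<in>UNIV. \<Sum>f | f \<in> UNIV \<and> f k = a. \<Sum>g\<in>UNIV. R $ (f, g) $ (f, g))"
    by (intro sum.cong refl sum.group) auto
  also have "\<dots> = (\<Sum>f\<in>UNIV. \<Sum>g\<in>UNIV. R $ (f, g) $ (f, g))"
    by (rule sum.group) auto
  finally show ?thesis by (simp add: trace_def sum_UNIV_prod)
qed

theorem measure_and_prepare:
  fixes R :: "(('n::finite \<Rightarrow> 'a::finite) \<times> ('n \<Rightarrow> 'b::finite)) op" and k :: 'n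
  assumes R: "positive_op R" and tr: "trace R = 1" and bose: "bose_symmetric_B R"
  shows "(1 / (real CARD('n) + real CARD('b))) *\<^sub>R
    (real CARD('n) *\<^sub>R reduced_op k R + tensor_op (marginal k (trace_B R)) (mat 1)) \<in> SEP"
    (is "?\<sigma> \<in> SEP")
proof -
  let ?n = "CARD('n)"
  obtain X :: "('b \<Rightarrow> real \<times> nat) set" and W \<psi> where X: "finite X" "\<And>x. x \<in> X \<Longrightarrow> W x \<ge> 0"
    and quad: "\<And>(g :: 'n \<Rightarrow> 'b) (h :: 'n \<Rightarrow> 'b) b b'.
      (\<Sum>x\<in>X. complex_of_real (W x) *
        (\<psi> x b * cnj (\<psi> x b') * ((\<Prod>i\<in>UNIV. \<psi> x (h i)) * cnj (\<Prod>i\<in>UNIV. \<psi> x (g i)))))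
      = (if add_mset b (range_mset h) = add_mset b' (range_mset g)
         then of_nat (\<Prod>c\<in>UNIV. fact (count (add_mset b' (range_mset g)) c)) else 0)"
    using gaussian_vector_quadrature[where 'n = 'n and 'b = 'b] by blast
  define \<Psi> where "\<Psi> x g = (\<Prod>i\<in>UNIV. \<psi> x (g i))" for x and g :: "'n \<Rightarrow> 'b"
  define A where "A x = marginal k (contraction_B (\<Psi> x) R)" for x
  define P :: "('b \<Rightarrow> real \<times> nat) \<Rightarrow> 'b op" where "P x = (\<chi> b b'. \<psi> x b * cnj (\<psi> x b'))" for x
  \<comment> \<open>The divisor is the trace of the sum with weights \<open>W\<close>, as computed
    from \<open>entry\<close>.\<close>
  define V where "V x = W x / (fact ?n * (real ?n + real CARD('b)))" for x
  have A: "positive_op (A x)" for x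
    unfolding A_def by (intro positive_op_marginal positive_op_contraction_B R)
  have P: "positive_op (P x)" for x
    by (rule positive_op_gram[where X = "{()}" and y = "\<lambda>_. \<psi> x"]) (simp add: P_def)
  have pos: "real ?n + real CARD('b) > 0" by (simp add: add_pos_pos)
  have entry: "(\<Sum>x\<in>X. of_real (W x) * (A x $ a $ a' * P x $ b $ b'))
      = fact ?n * ((if b = b' then marginal k (trace_B R) $ a $ a' else 0)
                   + of_nat ?n * reduced_op k R $ (a, b) $ (a', b'))" for a a' b b'
  proof -
    let ?S = "{f :: 'n \<Rightarrow> 'a. f k = a}"
    let ?t = "\<lambda>x f g h. R $ (f, g) $ (f(k := a'), h) *
      (of_real (W x) * (\<psi> x b * cnj (\<psi> x b') * (\<Psi> x h * cnj (\<Psi> x g))))"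
    have "(\<Sum>x\<in>X. of_real (W x) * (A x $ a $ a' * P x $ b $ b'))
        = (\<Sum>x\<in>X. \<Sum>f\<in>?S. \<Sum>g\<in>UNIV. \<Sum>h\<in>UNIV. ?t x f g h)"
      by (simp add: A_def P_def marginal_def contraction_B_def sum_distrib_left sum_distrib_right mult_ac)
    also have "\<dots> = (\<Sum>f\<in>?S. \<Sum>x\<in>X. \<Sum>g\<in>UNIV. \<Sum>h\<in>UNIV. ?t x f g h)"
      by (rule sum.swap)
    also have "\<dots> = (\<Sum>f\<in>?S. \<Sum>g\<in>UNIV. \<Sum>x\<in>X. \<Sum>h\<in>UNIV. ?t x f g h)"
      by (intro sum.cong refl sum.swap)
    also have "\<dots> = (\<Sum>f\<in>?S. \<Sum>g\<in>UNIV. \<Sum>h\<in>UNIV. \<Sum>x\<in>X. ?t x f g h)"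
      by (intro sum.cong refl sum.swap)
    also have "\<dots> = (\<Sum>f\<in>?S. \<Sum>g\<in>UNIV. fact ?n * ((if b = b' then R $ (f, g) $ (f(k := a'), g) else 0)
          + (\<Sum>i | g i = b. R $ (f, g) $ (f(k := a'), g(i := b')))))"
    proof (intro sum.cong refl)
      fix f and g :: "'n \<Rightarrow> 'b"
      show "(\<Sum>h\<in>UNIV. \<Sum>x\<in>X. ?t x f g h) = fact ?n * ((if b = b' then R $ (f, g) $ (f(k := a'), g) else 0)
          + (\<Sum>i | g i = b. R $ (f, g) $ (f(k := a'), g(i := b'))))"
        \<comment> \<open>The sum over \<open>x\<close> is a quadrature moment; the sum over
          \<open>h\<close> runs over column indices of \<open>R\<close>, where Bose symmetry
          supplies the required invariance.\<close>
        unfolding sum_distrib_left[symmetric] \<Psi>_def quad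
        by (rule sum_permutation_invariant) (rule bose_symmetric_B_column[OF bose R])
    qed
    also have "\<dots> = fact ?n * ((\<Sum>f\<in>?S. \<Sum>g\<in>UNIV. if b = b' then R $ (f, g) $ (f(k := a'), g) else 0)
          + (\<Sum>f\<in>?S. \<Sum>g\<in>UNIV. \<Sum>i | g i = b. R $ (f, g) $ (f(k := a'), g(i := b'))))"
      by (simp only: sum_distrib_left[symmetric] sum.distrib)
    also have "(\<Sum>f\<in>?S. \<Sum>g\<in>UNIV. if b = b' then R $ (f, g) $ (f(k := a'), g) else 0)
        = (if b = b' then marginal k (trace_B R) $ a $ a' else 0)"
      by (simp add: marginal_def trace_B_def)
    also have "(\<Sum>f\<in>?S. \<Sum>g\<in>UNIV. \<Sum>i | g i = b. R $ (f, g) $ (f(k := a'), g(i := b')))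
        = of_nat ?n * reduced_op k R $ (a, b) $ (a', b')"
    proof -
      have "(\<Sum>g\<in>UNIV. \<Sum>i | g i = b. R $ (f, g) $ (f(k := a'), g(i := b')))
          = of_nat ?n * (\<Sum>g | g k = b. R $ (f, g) $ (f(k := a'), g(k := b')))" for f
      proof -
        have "(\<Sum>g\<in>UNIV. \<Sum>i | g i = b. R $ (f, g) $ (f(k := a'), g(i := b')))
            = (\<Sum>i\<in>UNIV. \<Sum>g | g i = b. R $ (f, g) $ (f(k := a'), g(i := b')))"
          using sum.swap_restrict[of UNIV UNIV "\<lambda>g i. R $ (f, g) $ (f(k := a'), g(i := b'))" "\<lambda>g i. g i = b"]
          by simp
        also have "\<dots> = (\<Sum>i\<in>(UNIV :: 'n set). \<Sum>g | g k = b. R $ (f, g) $ (f(k := a'), g(k := b')))"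
          by (intro sum.cong refl sum_replace_coordinate_eq[OF bose R])
        finally show ?thesis by simp
      qed
      then show ?thesis by (simp add: reduced_op_def sum_distrib_left)
    qed
    finally show ?thesis .
  qed
  have eq: "(\<Sum>x\<in>X. V x *\<^sub>R tensor_op (A x) (P x)) = ?\<sigma>"
  proof -
    have "(\<Sum>x\<in>X. V x *\<^sub>R tensor_op (A x) (P x)) $ (a, b) $ (a', b') = ?\<sigma> $ (a, b) $ (a', b')" for a b a' b'
    proof -
      have "(\<Sum>x\<in>X. V x *\<^sub>R tensor_op (A x) (P x)) $ (a, b) $ (a', b')
          = (\<Sum>x\<in>X. of_real (W x) * (A x $ a $ a' * P x $ b $ b')) / of_real (fact ?n * (real ?n + real CARD('b)))"
        by (simp add: tensor_op_def V_def scaleR_conv_of_real[where 'a = complex] sum_divide_distrib)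
      also have "\<dots> = ((if b = b' then marginal k (trace_B R) $ a $ a' else 0)
            + of_nat ?n * reduced_op k R $ (a, b) $ (a', b')) / of_real (real ?n + real CARD('b))"
        unfolding entry by simp
      also have "\<dots> = ?\<sigma> $ (a, b) $ (a', b')"
        by (simp add: tensor_op_def mat_def scaleR_conv_of_real[where 'a = complex])
      finally show ?thesis .
    qed
    then show ?thesis by (simp add: vec_eq_iff split_paired_all)
  qed
  show ?thesis
    unfolding eq[symmetric]
  proof (rule sum_tensor_in_SEP[OF X(1) _ A P])
    show "V x \<ge> 0" if "x \<in> X" for x using X(2)[OF that] pos by (simp add: V_def)
    have "trace ?\<sigma> = of_real (1 / (real ?n + real CARD('b)) * (real ?n + real CARD('b)))"
      unfolding trace_scaleR trace_add trace_tensor_op trace_reduced_op trace_marginal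
        trace_trace_B trace_mat_1 tr
      by (simp only: of_real_mult of_real_add of_real_of_nat_eq mult_1_left mult_1_right)
    also have "\<dots> = 1" using pos by simp
    finally show "trace (\<Sum>x\<in>X. V x *\<^sub>R tensor_op (A x) (P x)) = 1"
      unfolding eq .
  qed
qed

text \<open>For \<open>dA = 1\<close> the claimed bound is 0, so \<open>\<rho>\<close> must itself
  be separable; on a one-dimensional first factor it is \<open>mat 1\<close> tensored with a
  state.\<close>

lemma state_in_SEP_of_card_1:
  fixes \<rho> :: "('a::finite \<times> 'b::finite) op"
  assumes "CARD('a) = 1" and \<rho>: "state \<rho>"
  shows "\<rho> \<in> SEP"
proof -
  obtain a0 :: 'a where UNIV_a: "(UNIV :: 'a set) = {a0}"
    using assms(1) by (rule card_1_singletonE)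
  then have a0: "a = a0" for a by blast
  define \<sigma> :: "'b op" where "\<sigma> = (\<chi> b b'. \<rho> $ (a0, b) $ (a0, b'))"
  obtain y :: "'a \<times> 'b \<Rightarrow> 'a \<times> 'b \<Rightarrow> complex"
    where y: "\<And>p q. \<rho> $ p $ q = (\<Sum>x\<in>UNIV. y x p * cnj (y x q))"
    using positive_op_imp_gram \<rho> unfolding state_def by blast
  have "positive_op \<sigma>"
    by (rule positive_op_gram[where X = UNIV and y = "\<lambda>x b. y x (a0, b)"]) (simp add: \<sigma>_def y)
  moreover have "trace \<sigma> = trace \<rho>" by (simp add: trace_def \<sigma>_def sum_UNIV_prod UNIV_a)
  ultimately have "state \<sigma>" using \<rho> by (simp add: state_def)
  moreover have "state (mat 1 :: 'a op)"
    using assms(1) by (simp add: state_def positive_op_mat_1 trace_mat_1)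
  moreover have "\<rho> = tensor_op (mat 1) \<sigma>"
  proof -
    have "\<rho> $ (a, b) $ (a', b') = tensor_op (mat 1) \<sigma> $ (a, b) $ (a', b')" for a a' b b'
      using a0[of a] a0[of a'] by (simp add: tensor_op_def mat_def \<sigma>_def)
    then show ?thesis by (simp add: vec_eq_iff split_paired_all)
  qed
  ultimately show ?thesis using product_state_in_SEP by metis
qed

text \<open>The factor \<open>ln 2\<close> turns the binary logarithm into a natural one, and
  \<open>n + dA\<close> is at least 3, hence at least \<open>exp 1\<close>.\<close>

lemma sqrt_log_bound_ge_1:
  assumes "dA \<ge> 2" "n \<ge> 1"
  shows "1 \<le> sqrt (4 * ln 2 * (real dA - 1) * log 2 (real n + real dA))"
proof -
  have "exp 1 \<le> real n + real dA" using exp_le assms by linarith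
  then have "1 \<le> ln (real n + real dA)"
    using assms by (subst ln_ge_iff) auto
  moreover have "1 \<le> 4 * (real dA - 1)" using assms by simp
  ultimately have "1 * 1 \<le> 4 * (real dA - 1) * ln (real n + real dA)"
    by (intro mult_mono) auto
  also have "\<dots> = 4 * ln 2 * (real dA - 1) * log 2 (real n + real dA)"
    by (simp add: log_def)
  finally show ?thesis by simp
qed

theorem theorem5p6:
  fixes \<rho> :: "('a::finite \<times> 'b::finite) op"
    and k :: "'n::finite"
    and n dA dB :: nat
  assumes "dA = CARD('a)" and "dB = CARD('b)" and "n = CARD('n)"
    and "state \<rho>"
    and "\<exists>R. bose_double_extension k R \<rho>"
  shows "\<exists>\<rho>'\<in>SEP. trace_norm (\<rho> - \<rho>') \<le>
    4 * real dA * real dB * (sqrt (4 * ln 2 * (real dA - 1) * log 2 (real n + real dA)) / real n)"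
proof (cases "dA = 1")
  case True
  have "positive_op (0 :: ('a \<times> 'b) op)"
    by (rule positive_op_gram[where X = "{}"]) simp
  then have "trace_norm (0 :: ('a \<times> 'b) op) \<le> 0"
    using trace_norm_diff_le[of "0 :: ('a \<times> 'b) op" 0] by (simp add: trace_def)
  then show ?thesis
    using state_in_SEP_of_card_1[OF _ assms(4)] True assms(1) by (intro bexI[of _ \<rho>]) simp_all
next
  case False
  have dims: "dA \<ge> 2" "dB \<ge> 1" "n \<ge> 1"
    using False assms(1-3) zero_less_card_finite[where 'a = 'a] zero_less_card_finite[where 'a = 'b]
      zero_less_card_finite[where 'a = 'n] by linarith+
  obtain R where R: "positive_op R" "trace R = 1" "reduced_op k R = \<rho>" "bose_symmetric_B R"
    using assms(5) unfolding bose_double_extension_def state_def by blast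
  define N where "N = real n + real dB"
  define Q where "Q = tensor_op (marginal k (trace_B R)) (mat 1 :: 'b op)"
  define \<sigma> where "\<sigma> = (1 / N) *\<^sub>R (real n *\<^sub>R \<rho> + Q)"
  have N: "N > 0" "N \<ge> real n" using dims by (auto simp: N_def)
  have "\<sigma> \<in> SEP"
    using measure_and_prepare[OF R(1,2,4), of k] by (simp add: \<sigma>_def Q_def N_def R(3) assms(2,3))
  have Q: "positive_op Q" "trace Q = of_nat dB"
    unfolding Q_def
    by (simp_all add: positive_op_tensor positive_op_marginal positive_op_trace_B positive_op_mat_1 R
        trace_tensor_op trace_marginal trace_trace_B trace_mat_1 assms(2))
  \<comment> \<open>Rewriting the weight of \<open>\<rho>\<close> in this way exhibits the error as
    a difference of two positive operators, each of trace \<open>dB / N\<close>.\<close>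
  have "real n / N = 1 - real dB / N"
    using N by (simp add: N_def field_simps)
  then have "\<rho> - \<sigma> = (real dB / N) *\<^sub>R \<rho> - (1 / N) *\<^sub>R Q"
    by (simp add: \<sigma>_def scaleR_add_right scaleR_diff_left)
  then have "trace_norm (\<rho> - \<sigma>) \<le> Re (trace ((real dB / N) *\<^sub>R \<rho>)) + Re (trace ((1 / N) *\<^sub>R Q))"
    using assms(4) Q(1) N by (auto intro!: trace_norm_diff_le positive_op_scaleR simp: state_def)
  also have "\<dots> = 2 * real dB / N"
    using assms(4) Q(2) by (simp add: trace_scaleR state_def)
  also have "\<dots> \<le> 2 * real dB / real n"
    using N dims by (intro divide_left_mono) auto
  also have "\<dots> \<le> 4 * real dA * real dB * (1 / real n)"
    using dims by (simp add: divide_right_mono)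
  also have "\<dots> \<le> 4 * real dA * real dB *
      (sqrt (4 * ln 2 * (real dA - 1) * log 2 (real n + real dA)) / real n)"
    using sqrt_log_bound_ge_1[OF dims(1,3)] dims
    by (intro mult_left_mono divide_right_mono) auto
  finally show ?thesis using \<open>\<sigma> \<in> SEP\<close> by blast
qed

end
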